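(* Let $(g,\mu,J)$ be a driven cofactor system in adapted coordinates $(y^i,x^a)$, with $J$ and $J_1$ nonsingular. Let $\bar J_2$ be the type $(1,1)$ tensor with components $\bar J_2{}^a_b=J^a_b-J^a_i(J_1^{-1})^i_jJ^j_b$, and consider, with the $y^i$ as external parameters and $E^1$ a constant, the function of $(x^a,\tilde p_a)$ $$H_{(n)}=\tfrac12(\det J_1)\,g^{ab}\tilde p_a\tilde p_b+(\operatorname{tr}\bar J_2)\,(E^1-W^1(y))+W_{(n)}(y,x).$$ Then $\bar J_2$ is a special conformal Killing tensor for the metric associated to the quadratic terms of $H_{(n)}$ (the metric with inverse $(\det J_1)g^{ab}$), and the remaining terms $U=(\operatorname{tr}\bar J_2)(E^1-W^1)+W_{(n)}$ satisfy the condition for an admissible potential for Hamilton–Jacobi separability, i.e. the 1-form $(\operatorname{cof}\bar J_2)(d_2U)$ is $d_2$-closed, where $d_2$ is the exterior derivative with respect to the $x^a$ (with $y$ fixed).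
   Context: Everything is smooth and the summation convention is used; coordinate domains are taken such that closed 1-forms are exact. Type $(1,1)$ tensors act on 1-forms by their adjoint. Special conformal Killing tensor (scKt) for a metric $g$: a type $(1,1)$ tensor field $J$, symmetric with respect to $g$, with $J_{\alpha\beta|\gamma}=\frac12(\alpha_\alpha g_{\beta\gamma}+\alpha_\beta g_{\alpha\gamma})$, where $J_{\alpha\beta}=g_{\alpha\gamma}J^\gamma_\beta$, the bar is the Levi-Civita covariant derivative of $g$, and (necessarily) $\alpha=d(\operatorname{tr}J)$. For $\bar J_2$ this is imposed for each fixed $y$, on the space of the $x^a$. The cofactor tensor $\operatorname{cof}J$ is defined by $J(\operatorname{cof}J)=(\operatorname{cof}J)J=(\det J)I$ (in general: the adjugate). $d_J$ is the degree 1 derivation of forms anticommuting with $d$ with $d_Jf=J(df)$, and $D_J\rho=d_J\rho+d(\operatorname{tr}J)\wedge\rho$. A cofactor system $(g,\mu,J)$ consists of a Riemannian metric $g$, a 1-form $\mu$ and a nonsingular scKt $J$ for $g$ with $D_J\mu=0$. Driven cofactor system in adapted coordinates: a cofactor system on a manifold of dimension $N=m+n$ with coordinates $(y^i,x^a)$, $i=1,\dots,m$, $a=1,\dots,n$, such that $g=g_{ij}(y)dy^i\otimes dy^j+g_{ab}(x)dx^a\otimes dx^b$ (no mixed terms) and $\mu=\mu_1+\mu_2$ with $\mu_1=Q_i(y)dy^i$, $\mu_2=Q_a(x,y)dx^a$, $Q_a=-\partial V/\partial x^a$ for a function $V(x,y)$, and the $\partial Q_a/\partial y^i$ are not all zero.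 $K=\mathrm{span}\{\partial/\partial x^a\}$, $K^\perp=\mathrm{span}\{\partial/\partial y^i\}$, $P_1,P_2$ are the complementary projectors onto $K^\perp$ and $K$; $J_1=P_1JP_1$ has components $J^i_j$ (depending on $y$ only); nonsingularity, inverse, determinant, trace and cofactor of $J_1$ (resp. $\bar J_2$) refer to the restriction to $K^\perp$ (resp. $K$). Let $A(a)=\operatorname{cof}(J+aP_2)=\sum_{i=1}^{n+1}A_{(i)}a^{i-1}$. Each $A_{(i)}\mu$ is closed; $W_{(i)}$ is defined (up to a constant) by $A_{(i)}\mu=-dW_{(i)}$. $W^1(y)$ is the function with $(\operatorname{cof}J_1)\mu_1=-dW^1$. ($E^1$ is the constant value, along a solution of the driving system, of its quadratic first integral $\frac12(\operatorname{cof}J_1)_{ij}\dot y^i\dot y^j+W^1(y)$.) *)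

theory Defs
  imports "HOL-Analysis.Analysis"
begin

text \<open>
  Everything takes place in one coordinate chart, an open subset of \<open>real ^ 'k\<close>. Fields are given
  by their components in the coordinate frame: a 1-form is a field of covectors, a 2-form a field of
  (antisymmetric) matrices, a metric a field of symmetric matrices, and a type (1,1) tensor \<open>J\<close> a
  field of matrices with \<open>J p $ i $ j\<close> the component with upper index \<open>i\<close> and lower index \<open>j\<close>.
  Fields are total functions; only their values on the chart matter.
\<close>

section \<open>Smooth fields and exterior calculus\<close>

definition pd :: "'k::finite \<Rightarrow> (real^'k \<Rightarrow> real) \<Rightarrow> real^'k \<Rightarrow> real" where
  "pd i f p = frechet_derivative f (at p) (axis i 1)"

primrec Ck_on :: "nat \<Rightarrow> (real^'k::finite) set \<Rightarrow> (real^'k \<Rightarrow> real) \<Rightarrow> bool" where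
  "Ck_on 0 S f \<longleftrightarrow> continuous_on S f"
| "Ck_on (Suc k) S f \<longleftrightarrow> (\<forall>p\<in>S. f differentiable (at p)) \<and> (\<forall>i. Ck_on k S (pd i f))"

definition smooth_on :: "(real^'k::finite) set \<Rightarrow> (real^'k \<Rightarrow> real) \<Rightarrow> bool" where
  "smooth_on S f \<longleftrightarrow> (\<forall>k. Ck_on k S f)"

definition smooth_form :: "(real^'k::finite) set \<Rightarrow> (real^'k \<Rightarrow> real^'k) \<Rightarrow> bool" where
  "smooth_form S \<rho> \<longleftrightarrow> (\<forall>i. smooth_on S (\<lambda>p. \<rho> p $ i))"

definition smooth_matrix :: "(real^'k::finite) set \<Rightarrow> (real^'k \<Rightarrow> real^'k^'k) \<Rightarrow> bool" where
  "smooth_matrix S T \<longleftrightarrow> (\<forall>i j. smooth_on S (\<lambda>p. T p $ i $ j))"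

definition d0 :: "(real^'k::finite \<Rightarrow> real) \<Rightarrow> real^'k \<Rightarrow> real^'k" where
  "d0 f p = (\<chi> i. pd i f p)"

definition d1 :: "(real^'k::finite \<Rightarrow> real^'k) \<Rightarrow> real^'k \<Rightarrow> real^'k^'k" where
  "d1 \<rho> p = (\<chi> k l. pd k (\<lambda>q. \<rho> q $ l) p - pd l (\<lambda>q. \<rho> q $ k) p)"

definition wedge :: "real^'k::finite \<Rightarrow> real^'k \<Rightarrow> real^'k^'k" where
  "wedge \<alpha> \<beta> = (\<chi> k l. \<alpha> $ k * \<beta> $ l - \<alpha> $ l * \<beta> $ k)"

definition closed_form :: "(real^'k::finite) set \<Rightarrow> (real^'k \<Rightarrow> real^'k) \<Rightarrow> bool" where
  "closed_form S \<rho> \<longleftrightarrow> smooth_form S \<rho> \<and> (\<forall>p\<in>S. d1 \<rho> p = 0)"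

definition coordinate_domain :: "(real^'k::finite) set \<Rightarrow> bool" where
  "coordinate_domain S \<longleftrightarrow> open S \<and>
     (\<forall>\<rho>. closed_form S \<rho> \<longrightarrow> (\<exists>f. smooth_on S f \<and> (\<forall>p\<in>S. d0 f p = \<rho> p)))"

section \<open>Cofactor tensors\<close>

text \<open>
  Entry \<open>(i, j)\<close> of the adjugate is the determinant of \<open>A\<close> with column \<open>i\<close> replaced by the
  \<open>j\<close>-th unit vector.
\<close>

definition adjugate :: "real^'k^'k \<Rightarrow> real^'k::finite^'k" where
  "adjugate A = (\<chi> i j. det (\<chi> k l. if l = i then axis j 1 $ k else A $ k $ l))"

lemma adjugate_mult_vec:
  fixes A :: "real^'k::finite^'k"
  shows "(adjugate A *v b) $ i = det (\<chi> k l. if l = i then b $ k else A $ k $ l)"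
proof -
  let ?B = "\<lambda>v::real^'k. (\<chi> r. if r = i then v else column r A)"
  have rows: "det (\<chi> k l. if l = i then v $ k else A $ k $ l) = det (?B v)" for v
  proof -
    have "transpose (?B v) = (\<chi> k l. if l = i then v $ k else A $ k $ l)"
      by (simp add: transpose_def column_def vec_eq_iff)
    then show ?thesis using det_transpose[of "?B v"] by (simp only:)
  qed
  have "(adjugate A *v b) $ i = (\<Sum>j\<in>UNIV. det (?B (axis j 1)) * b $ j)"
    by (simp only: matrix_vector_mult_def adjugate_def vec_lambda_beta rows)
  also have "\<dots> = (\<Sum>j\<in>UNIV. det (?B (b $ j *s axis j 1)))"
    using det_row_mul[of i _ "\<lambda>_. axis _ 1" "\<lambda>r. column r A"] by (simp only: mult.commute)
  also have "\<dots> = det (?B (\<Sum>j\<in>UNIV. b $ j *s axis j 1))"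
    using det_linear_row_sum[of UNIV i "\<lambda>_ j. b $ j *s axis j 1" "\<lambda>r. column r A"] by simp
  also have "(\<Sum>j\<in>UNIV. b $ j *s axis j 1) = b"
    by (rule basis_expansion)
  finally show ?thesis by (simp add: rows)
qed

lemma adjugate_mult_left: "adjugate A ** A = det A *\<^sub>R mat 1"
proof -
  have "(adjugate A *v (A *v x)) $ i = (det A *\<^sub>R x) $ i" for x i
    by (simp add: adjugate_mult_vec cramer_lemma)
  then have "(adjugate A ** A) *v x = (det A *\<^sub>R mat 1) *v x" for x
    by (simp add: vec_eq_iff matrix_vector_mul_assoc[symmetric] scaleR_matrix_vector_assoc[symmetric])
  then show ?thesis by (simp add: matrix_eq)
qed

lemma adjugate_mult_right:
  assumes "invertible A"
  shows "A ** adjugate A = det A *\<^sub>R mat 1"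
proof -
  have dA: "det A \<noteq> 0" using assms by (simp add: invertible_det_nz)
  have "((1 / det A) *\<^sub>R adjugate A) ** A = mat 1"
    using dA by (simp add: scalar_matrix_assoc[symmetric] adjugate_mult_left)
  then have "A ** ((1 / det A) *\<^sub>R adjugate A) = mat 1"
    by (rule iffD1[OF matrix_left_right_inverse])
  then have "(1 / det A) *\<^sub>R (A ** adjugate A) = mat 1"
    by (simp only: matrix_scalar_ac scalar_matrix_assoc[symmetric])
  then have "det A *\<^sub>R ((1 / det A) *\<^sub>R (A ** adjugate A)) = det A *\<^sub>R mat 1"
    by simp
  then show ?thesis using dA by simp
qed

section \<open>Special conformal Killing tensors and cofactor systems\<close>

definition pseudo_riemannian :: "(real^'k::finite) set \<Rightarrow> (real^'k \<Rightarrow> real^'k^'k) \<Rightarrow> bool" where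
  "pseudo_riemannian S g \<longleftrightarrow> smooth_matrix S g \<and>
     (\<forall>p\<in>S. transpose (g p) = g p \<and> invertible (g p))"

definition riemannian :: "(real^'k::finite) set \<Rightarrow> (real^'k \<Rightarrow> real^'k^'k) \<Rightarrow> bool" where
  "riemannian S g \<longleftrightarrow> smooth_matrix S g \<and>
     (\<forall>p\<in>S. transpose (g p) = g p \<and> (\<forall>v. v \<noteq> 0 \<longrightarrow> v \<bullet> (g p *v v) > 0))"

definition christoffel ::
    "(real^'k::finite \<Rightarrow> real^'k^'k) \<Rightarrow> 'k \<Rightarrow> 'k \<Rightarrow> 'k \<Rightarrow> real^'k \<Rightarrow> real" where
  "christoffel g i j k p = (1/2) * (\<Sum>l\<in>UNIV. matrix_inv (g p) $ i $ l *
     (pd j (\<lambda>q. g q $ l $ k) p + pd k (\<lambda>q. g q $ l $ j) p - pd l (\<lambda>q. g q $ j $ k) p))"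

definition cov_deriv ::
    "(real^'k::finite \<Rightarrow> real^'k^'k) \<Rightarrow> (real^'k \<Rightarrow> real^'k^'k) \<Rightarrow> 'k \<Rightarrow> 'k \<Rightarrow> 'k \<Rightarrow> real^'k \<Rightarrow> real" where
  "cov_deriv g B a b c p = pd c (\<lambda>q. B q $ a $ b) p
     - (\<Sum>e\<in>UNIV. christoffel g e a c p * B p $ e $ b)
     - (\<Sum>e\<in>UNIV. christoffel g e b c p * B p $ a $ e)"

text \<open>
  The metric may be indefinite. The matrix product \<open>g p ** J p\<close> is \<open>J\<close> with its upper index lowered,
  so its symmetry is the symmetry of \<open>J\<close> with respect to \<open>g\<close>.
\<close>

definition scKt :: "(real^'k::finite) set \<Rightarrow> (real^'k \<Rightarrow> real^'k^'k) \<Rightarrow> (real^'k \<Rightarrow> real^'k^'k) \<Rightarrow> bool" where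
  "scKt S g J \<longleftrightarrow> pseudo_riemannian S g \<and> smooth_matrix S J \<and>
     (\<forall>p\<in>S. transpose (g p ** J p) = g p ** J p) \<and>
     (\<forall>p\<in>S. \<forall>a b c. let \<alpha> = d0 (\<lambda>q. trace (J q)) p in
        cov_deriv g (\<lambda>q. g q ** J q) a b c p
          = (1/2) * (\<alpha> $ a * g p $ b $ c + \<alpha> $ b * g p $ a $ c))"

text \<open>
  The adjoint action of \<open>J\<close> on covectors is \<open>\<rho> v* J\<close>. For functions \<open>d\<^sub>J f = J (df)\<close>. On a 1-form
  \<open>\<rho> = \<Sum>i. \<rho>\<^sub>i dx\<^sup>i\<close> the derivation property and \<open>d\<^sub>J d = - d d\<^sub>J\<close> give
  \<open>d\<^sub>J \<rho> = \<Sum>i. d\<^sub>J \<rho>\<^sub>i \<and> dx\<^sup>i - \<rho>\<^sub>i d (J dx\<^sup>i)\<close>; the lemmas below confirm both properties.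
\<close>

definition dJ0 :: "(real^'k::finite \<Rightarrow> real^'k^'k) \<Rightarrow> (real^'k \<Rightarrow> real) \<Rightarrow> real^'k \<Rightarrow> real^'k" where
  "dJ0 J f p = d0 f p v* J p"

definition dJ1 :: "(real^'k::finite \<Rightarrow> real^'k^'k) \<Rightarrow> (real^'k \<Rightarrow> real^'k) \<Rightarrow> real^'k \<Rightarrow> real^'k^'k" where
  "dJ1 J \<rho> p = (\<Sum>i\<in>UNIV. wedge (dJ0 J (\<lambda>q. \<rho> q $ i) p) (axis i 1)
                  - (\<rho> p $ i) *\<^sub>R d1 (\<lambda>q. axis i 1 v* J q) p)"

definition DJ1 :: "(real^'k::finite \<Rightarrow> real^'k^'k) \<Rightarrow> (real^'k \<Rightarrow> real^'k) \<Rightarrow> real^'k \<Rightarrow> real^'k^'k" where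
  "DJ1 J \<rho> p = dJ1 J \<rho> p + wedge (d0 (\<lambda>q. trace (J q)) p) (\<rho> p)"

lemma pd_mult:
  assumes "f differentiable (at p)" "h differentiable (at p)"
  shows "pd i (\<lambda>q. f q * h q) p = pd i f p * h p + f p * pd i h p"
proof -
  have "((\<lambda>q. f q * h q) has_derivative
      (\<lambda>v. f p * frechet_derivative h (at p) v + frechet_derivative f (at p) v * h p)) (at p)"
    using assms by (intro has_derivative_mult) (auto simp: frechet_derivative_works)
  from frechet_derivative_at[OF this, symmetric] show ?thesis by (simp add: pd_def)
qed

lemma dJ1_leibniz:
  assumes "f differentiable (at p)" "\<And>i. (\<lambda>q. \<rho> q $ i) differentiable (at p)"
  shows "dJ1 J (\<lambda>q. f q *\<^sub>R \<rho> q) p = wedge (dJ0 J f p) (\<rho> p) + f p *\<^sub>R dJ1 J \<rho> p"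
proof -
  have d: "dJ0 J (\<lambda>q. f q * \<rho> q $ i) p = (\<rho> p $ i) *\<^sub>R dJ0 J f p + f p *\<^sub>R dJ0 J (\<lambda>q. \<rho> q $ i) p" for i
    by (simp add: dJ0_def d0_def pd_mult assms vec_eq_iff vector_matrix_mult_def
        algebra_simps sum.distrib sum_distrib_left)
  have w: "(\<Sum>i\<in>UNIV. wedge ((\<rho> p $ i) *\<^sub>R \<beta>) (axis i 1)) = wedge \<beta> (\<rho> p)" for \<beta>
    by (simp add: wedge_def vec_eq_iff axis_def sum_subtractf if_distrib[of "\<lambda>x. _ * x"] eq_commute
        mult.commute[of "\<rho> p $ _"] cong: if_cong)
  have "dJ1 J (\<lambda>q. f q *\<^sub>R \<rho> q) p = (\<Sum>i\<in>UNIV. wedge ((\<rho> p $ i) *\<^sub>R dJ0 J f p) (axis i 1)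
      + f p *\<^sub>R (wedge (dJ0 J (\<lambda>q. \<rho> q $ i) p) (axis i 1)
                  - (\<rho> p $ i) *\<^sub>R d1 (\<lambda>q. axis i 1 v* J q) p))"
    unfolding dJ1_def
    by (intro sum.cong) (simp_all add: d wedge_def vec_eq_iff algebra_simps)
  also have "\<dots> = wedge (dJ0 J f p) (\<rho> p) + f p *\<^sub>R dJ1 J \<rho> p"
    by (simp add: sum.distrib w dJ1_def scaleR_sum_right)
  finally show ?thesis .
qed

lemma pd_sum:
  assumes "\<And>k. k \<in> K \<Longrightarrow> f k differentiable (at p)"
  shows "pd i (\<lambda>q. \<Sum>k\<in>K. f k q) p = (\<Sum>k\<in>K. pd i (f k) p)"
proof -
  have "((\<lambda>q. \<Sum>k\<in>K. f k q) has_derivative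
      (\<lambda>v. \<Sum>k\<in>K. frechet_derivative (f k) (at p) v)) (at p)"
    using assms by (intro has_derivative_sum) (auto simp: frechet_derivative_works)
  from frechet_derivative_at[OF this, symmetric] show ?thesis by (simp add: pd_def)
qed

lemma dJ1_d0:
  assumes f: "\<And>i. pd i f differentiable (at p)"
    and symm: "\<And>i j. pd i (pd j f) p = pd j (pd i f) p"
    and J: "\<And>i j. (\<lambda>q. J q $ i $ j) differentiable (at p)"
  shows "dJ1 J (d0 f) p = - d1 (dJ0 J f) p"
proof -
  have c: "dJ0 J f q $ l = (\<Sum>i\<in>UNIV. pd i f q * J q $ i $ l)" for q l
    by (simp add: dJ0_def d0_def vector_matrix_mult_def)
  have pdc: "pd k (\<lambda>q. dJ0 J f q $ l) p =
      (\<Sum>i\<in>UNIV. pd k (pd i f) p * J p $ i $ l + pd i f p * pd k (\<lambda>q. J q $ i $ l) p)" for k l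
    unfolding c
    by (subst pd_sum) (auto simp: pd_mult f J intro!: derivative_intros differentiable_mult)
  have a: "(axis i 1 v* J q) $ l = J q $ i $ l" for i l q
    by (simp add: vector_matrix_mult_def axis_def if_distrib[of "\<lambda>x. x * _"] cong: if_cong)
  have w: "wedge \<beta> (axis i 1) $ k $ l = (if i = l then \<beta> $ k else 0) - (if i = k then \<beta> $ l else 0)"
    for \<beta> :: "real^'a" and i k l
    by (simp add: wedge_def axis_def)
  have e: "dJ0 J (\<lambda>q. pd l f q) p $ k = (\<Sum>i\<in>UNIV. pd l (pd i f) p * J p $ i $ k)" for k l
    by (simp add: dJ0_def d0_def vector_matrix_mult_def symm[of l])
  have "dJ1 J (d0 f) p $ k $ l = dJ0 J (\<lambda>q. pd l f q) p $ k - dJ0 J (\<lambda>q. pd k f q) p $ l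
      - (\<Sum>i\<in>UNIV. pd i f p * (pd k (\<lambda>q. J q $ i $ l) p - pd l (\<lambda>q. J q $ i $ k) p))" for k l
    by (simp add: dJ1_def sum_subtractf w a d1_def d0_def)
  then have "dJ1 J (d0 f) p $ k $ l = - d1 (dJ0 J f) p $ k $ l" for k l
    by (simp add: e d1_def pdc sum.distrib sum_subtractf right_diff_distrib)
  then show ?thesis by (simp add: vec_eq_iff)
qed

definition cofactor_system ::
    "(real^'k::finite) set \<Rightarrow> (real^'k \<Rightarrow> real^'k^'k) \<Rightarrow> (real^'k \<Rightarrow> real^'k) \<Rightarrow> (real^'k \<Rightarrow> real^'k^'k) \<Rightarrow> bool" where
  "cofactor_system S g \<mu> J \<longleftrightarrow> riemannian S g \<and> smooth_form S \<mu> \<and> scKt S g J \<and>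
     (\<forall>p\<in>S. invertible (J p)) \<and> (\<forall>p\<in>S. DJ1 J \<mu> p = 0)"

section \<open>Adapted coordinates\<close>

text \<open>
  The coordinates are indexed by the sum type \<open>'m + 'n\<close>: \<open>p $ Inl i\<close> is \<open>y\<^sup>i\<close> and \<open>p $ Inr a\<close> is
  \<open>x\<^sup>a\<close>, so that \<open>m = CARD('m)\<close> and \<open>n = CARD('n)\<close>.
\<close>

definition yx :: "real^'m::finite \<Rightarrow> real^'n::finite \<Rightarrow> real^('m + 'n)" where
  "yx y x = (\<chi> k. case k of Inl i \<Rightarrow> y $ i | Inr a \<Rightarrow> x $ a)"

definition ypart :: "real^('m::finite + 'n::finite) \<Rightarrow> real^'m" where
  "ypart p = (\<chi> i. p $ Inl i)"

definition xpart :: "real^('m::finite + 'n::finite) \<Rightarrow> real^'n" where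
  "xpart p = (\<chi> a. p $ Inr a)"

definition x_slice :: "(real^('m::finite + 'n::finite)) set \<Rightarrow> real^'m \<Rightarrow> (real^'n) set" where
  "x_slice S y = {x. yx y x \<in> S}"

definition block11 :: "real^('m::finite + 'n::finite)^('m + 'n) \<Rightarrow> real^'m^'m" where
  "block11 A = (\<chi> i j. A $ Inl i $ Inl j)"

definition block12 :: "real^('m::finite + 'n::finite)^('m + 'n) \<Rightarrow> real^'n^'m" where
  "block12 A = (\<chi> i b. A $ Inl i $ Inr b)"

definition block21 :: "real^('m::finite + 'n::finite)^('m + 'n) \<Rightarrow> real^'m^'n" where
  "block21 A = (\<chi> a j. A $ Inr a $ Inl j)"

definition block22 :: "real^('m::finite + 'n::finite)^('m + 'n) \<Rightarrow> real^'n^'n" where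
  "block22 A = (\<chi> a b. A $ Inr a $ Inr b)"

definition P2 :: "real^('m::finite + 'n::finite)^('m + 'n)" where
  "P2 = (\<chi> k l. if k = l \<and> k \<in> range Inr then 1 else 0)"

definition driven_cofactor_system ::
    "(real^('m::finite + 'n::finite)) set \<Rightarrow> (real^('m + 'n) \<Rightarrow> real^('m + 'n)^('m + 'n)) \<Rightarrow>
     (real^('m + 'n) \<Rightarrow> real^('m + 'n)) \<Rightarrow> (real^('m + 'n) \<Rightarrow> real^('m + 'n)^('m + 'n)) \<Rightarrow> bool" where
  "driven_cofactor_system S g \<mu> J \<longleftrightarrow>
     coordinate_domain S \<and> cofactor_system S g \<mu> J \<and>
     (\<forall>p\<in>S. block12 (g p) = 0 \<and> block21 (g p) = 0) \<and>
     (\<forall>p\<in>S. \<forall>q\<in>S. ypart p = ypart q \<longrightarrow> block11 (g p) = block11 (g q)) \<and>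
     (\<forall>p\<in>S. \<forall>q\<in>S. xpart p = xpart q \<longrightarrow> block22 (g p) = block22 (g q)) \<and>
     (\<forall>p\<in>S. \<forall>q\<in>S. ypart p = ypart q \<longrightarrow> ypart (\<mu> p) = ypart (\<mu> q)) \<and>
     (\<exists>V. smooth_on S V \<and> (\<forall>p\<in>S. \<forall>a. \<mu> p $ Inr a = - pd (Inr a) V p)) \<and>
     (\<exists>p\<in>S. \<exists>i a. pd (Inl i) (\<lambda>q. \<mu> q $ Inr a) p \<noteq> 0)"

text \<open>\<open>J1 J\<close> and \<open>J2bar J\<close> are represented by their restrictions to \<open>K\<^sup>\<bottom>\<close> and \<open>K\<close>.\<close>

definition J1 :: "(real^('m::finite + 'n::finite) \<Rightarrow> real^('m + 'n)^('m + 'n)) \<Rightarrow>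
    real^('m + 'n) \<Rightarrow> real^'m^'m" where
  "J1 J p = block11 (J p)"

definition J2bar :: "(real^('m::finite + 'n::finite) \<Rightarrow> real^('m + 'n)^('m + 'n)) \<Rightarrow>
    real^('m + 'n) \<Rightarrow> real^'n^'n" where
  "J2bar J p = block22 (J p) - block21 (J p) ** matrix_inv (J1 J p) ** block12 (J p)"

section \<open>Natural Hamiltonians\<close>

text \<open>
  \<open>h\<close> is the metric associated to the quadratic terms of \<open>H\<close>, and \<open>U\<close> consists of the remaining terms.
\<close>

definition natural_hamiltonian :: "(real^'k::finite) set \<Rightarrow> (real^'k \<Rightarrow> real^'k^'k) \<Rightarrow>
    (real^'k \<Rightarrow> real) \<Rightarrow> (real^'k \<Rightarrow> real^'k \<Rightarrow> real) \<Rightarrow> bool" where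
  "natural_hamiltonian S h U H \<longleftrightarrow> (\<forall>x\<in>S. \<forall>p. H x p =
     (1/2) * (\<Sum>a\<in>UNIV. \<Sum>b\<in>UNIV. matrix_inv (h x) $ a $ b * p $ a * p $ b) + U x)"

definition admissible_potential ::
    "(real^'k::finite) set \<Rightarrow> (real^'k \<Rightarrow> real^'k^'k) \<Rightarrow> (real^'k \<Rightarrow> real) \<Rightarrow> bool" where
  "admissible_potential S K U \<longleftrightarrow> smooth_on S U \<and> closed_form S (\<lambda>x. d0 U x v* adjugate (K x))"

end

theory Submission
  imports Defs
begin

text \<open>
  The Schur complement of \<open>J + a P\<^sub>2\<close> with respect to the block \<open>J\<^sub>1\<close> is \<open>J\<^sub>2 + a I\<close>, where \<open>J\<^sub>2\<close> is
  the tensor \<open>J2bar J\<close>. Block elimination therefore gives the \<open>x\<close>-columns of \<open>cof (J + a P\<^sub>2)\<close>,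
  multiplied by \<open>J\<^sub>2 + a I\<close>, as \<open>det J\<^sub>1 det (J\<^sub>2 + a I) Y\<close> with \<open>Y\<close> independent of \<open>a\<close>. Comparing
  leading coefficients in \<open>a\<close>, the \<open>x\<close>-columns of \<open>A\<^sub>(\<^sub>n\<^sub>)\<close> are \<open>(det J\<^sub>1) Y\<close>; at \<open>a = 0\<close>, those of
  \<open>cof J\<close> are the \<open>x\<close>-columns of \<open>A\<^sub>(\<^sub>n\<^sub>)\<close> times \<open>cof J\<^sub>2\<close>. Hence \<open>(cof J\<^sub>2) (d\<^sub>2 W\<^sub>(\<^sub>n\<^sub>))\<close> is, up to
  sign, the restriction to the slice of \<open>(cof J) \<mu>\<close>, which is closed because \<open>D\<^sub>J \<mu> = 0\<close> and the
  Nijenhuis torsion of \<open>J\<close> vanishes. For any special conformal Killing tensor,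
  \<open>(cof J) (d tr J) = d (det J)\<close>, which settles the term with \<open>tr J\<^sub>2\<close>. That \<open>J\<^sub>2\<close> is special
  conformal Killing follows by differentiating the Schur complement along the slice, on which
  \<open>J\<^sub>1\<close> is constant.
\<close>

section \<open>Calculus of partial derivatives on open sets\<close>

text \<open>\<open>frechet_derivative\<close> is a choice from the set of derivatives at
  \<open>p\<close>. Agreement near \<open>p\<close> makes the two sets equal, so the choices agree
  even where both sets are empty.\<close>

lemma frechet_derivative_cong_open:
  assumes "open S" "p \<in> S" "\<And>q. q \<in> S \<Longrightarrow> f q = h q"
  shows "frechet_derivative f (at p) = frechet_derivative h (at p)"
proof -
  have "(f has_derivative f') (at p) \<longleftrightarrow> (h has_derivative f') (at p)" for f'
    by (metis assms has_derivative_transform_within_open)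
  then show ?thesis by (simp add: frechet_derivative_def)
qed

lemma pd_cong_open:
  assumes "open S" "p \<in> S" "\<And>q. q \<in> S \<Longrightarrow> f q = h q"
  shows "pd i f p = pd i h p"
  by (simp add: pd_def frechet_derivative_cong_open[OF assms])

lemma pd_const [simp]: "pd i (\<lambda>q. c) p = 0"
  by (simp add: pd_def)

lemma pd_add:
  assumes "f differentiable (at p)" "h differentiable (at p)"
  shows "pd i (\<lambda>q. f q + h q) p = pd i f p + pd i h p"
  using frechet_derivative_at[OF has_derivative_add[OF assms[unfolded frechet_derivative_works]], symmetric]
  by (simp add: pd_def)

lemma pd_cmult:
  assumes "f differentiable (at p)"
  shows "pd i (\<lambda>q. c * f q) p = c * pd i f p"
  using assms by (simp add: pd_mult)

lemma pd_minus:
  assumes "f differentiable (at p)"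
  shows "pd i (\<lambda>q. - f q) p = - pd i f p"
  using pd_cmult[OF assms, of i "-1"] by simp

lemma pd_diff:
  assumes "f differentiable (at p)" "h differentiable (at p)"
  shows "pd i (\<lambda>q. f q - h q) p = pd i f p - pd i h p"
  using pd_add[OF assms(1) differentiable_minus[OF assms(2)]] assms(2) by (simp add: pd_minus)

lemma pd_inverse:
  assumes "f differentiable (at p)" "f p \<noteq> 0"
  shows "pd i (\<lambda>q. inverse (f q)) p = - pd i f p * (inverse (f p) * inverse (f p))"
  using frechet_derivative_at[OF Deriv.has_derivative_inverse[OF assms(2) assms(1)[unfolded frechet_derivative_works]], symmetric]
  by (simp add: pd_def)

section \<open>Closure properties of smooth functions\<close>

text \<open>The formulas for \<open>pd\<close> of a product or an inverse hold only at points of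
  \<open>S\<close>, whereas fields are total functions. This lemma lets such a formula replace the
  derivative in the inductions below.\<close>

lemma Ck_on_cong:
  assumes "open S" "\<And>q. q \<in> S \<Longrightarrow> f q = h q"
  shows "Ck_on k S f \<longleftrightarrow> Ck_on k S h"
  using assms(2)
proof (induction k arbitrary: f h)
  case 0
  then show ?case by (auto intro: continuous_on_cong)
next
  case (Suc k)
  have "f differentiable (at p) \<longleftrightarrow> h differentiable (at p)" if "p \<in> S" for p
    unfolding differentiable_def
    by (metis Suc.prems assms(1) has_derivative_transform_within_open that)
  moreover have "Ck_on k S (pd i f) \<longleftrightarrow> Ck_on k S (pd i h)" for i
    by (rule Suc.IH) (rule pd_cong_open[OF assms(1) _ Suc.prems])
  ultimately show ?case by simp
qed

lemma Ck_on_SucD: "Ck_on (Suc k) S f \<Longrightarrow> Ck_on k S f"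
proof (induction k arbitrary: f)
  case 0
  then show ?case
    by (auto intro!: continuous_at_imp_continuous_on differentiable_imp_continuous_within)
qed auto

lemma Ck_on_const: "Ck_on k S (\<lambda>q. c)"
proof (induction k arbitrary: c)
  case (Suc k)
  have "pd i (\<lambda>q. c) = (\<lambda>q. 0)" for i :: 'a by auto
  then show ?case using Suc by simp
qed simp

lemma Ck_on_add:
  assumes "open S" "Ck_on k S f" "Ck_on k S h"
  shows "Ck_on k S (\<lambda>q. f q + h q)"
  using assms(2,3)
proof (induction k arbitrary: f h)
  case 0
  then show ?case by (auto intro: continuous_on_add)
next
  case (Suc k)
  have "Ck_on k S (pd i (\<lambda>q. f q + h q))" for i
    using Suc by (subst Ck_on_cong[OF assms(1), of _ "\<lambda>q. pd i f q + pd i h q"]) (auto simp: pd_add)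
  then show ?case using Suc.prems by auto
qed

lemma Ck_on_mult:
  assumes "open S" "Ck_on k S f" "Ck_on k S h"
  shows "Ck_on k S (\<lambda>q. f q * h q)"
  using assms(2,3)
proof (induction k arbitrary: f h)
  case 0
  then show ?case by (auto intro: continuous_on_mult)
next
  case (Suc k)
  have "Ck_on k S (pd i (\<lambda>q. f q * h q))" for i
  proof (subst Ck_on_cong[OF assms(1)])
    show "pd i (\<lambda>q. f q * h q) q = pd i f q * h q + f q * pd i h q" if "q \<in> S" for q
      using Suc.prems that by (simp add: pd_mult)
    show "Ck_on k S (\<lambda>q. pd i f q * h q + f q * pd i h q)"
      \<comment> \<open>Each term of the product rule keeps one undifferentiated factor, which the
        induction hypothesis wants in class \<open>k\<close> instead of
        \<open>Suc k\<close>.\<close>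
      using Suc.prems Ck_on_SucD[OF Suc.prems(1)] Ck_on_SucD[OF Suc.prems(2)]
      by (intro Ck_on_add assms(1) Suc.IH) auto
  qed
  then show ?case using Suc.prems by auto
qed

text \<open>The derivative of 1/f is built from the derivative of f and 1/f itself, so the induction
  runs with \<open>f\<close> fixed.\<close>

lemma Ck_on_inverse:
  assumes "open S" "Ck_on k S f" "\<And>q. q \<in> S \<Longrightarrow> f q \<noteq> 0"
  shows "Ck_on k S (\<lambda>q. inverse (f q))"
  using assms(2)
proof (induction k)
  case 0
  then show ?case using assms(3) by (auto intro: continuous_on_inverse)
next
  case (Suc k)
  have inv: "Ck_on k S (\<lambda>q. inverse (f q))"
    using Suc.IH Ck_on_SucD[OF Suc.prems] by blast
  have "Ck_on k S (pd i (\<lambda>q. inverse (f q)))" for i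
  proof (subst Ck_on_cong[OF assms(1)])
    show "pd i (\<lambda>q. inverse (f q)) q = - 1 * pd i f q * (inverse (f q) * inverse (f q))" if "q \<in> S" for q
      using Suc.prems that assms(3) by (simp add: pd_inverse)
    show "Ck_on k S (\<lambda>q. - 1 * pd i f q * (inverse (f q) * inverse (f q)))"
      using Suc.prems by (intro Ck_on_mult Ck_on_const assms(1) inv) auto
  qed
  then show ?case using Suc.prems assms(3) by auto
qed

lemma smooth_on_cong:
  assumes "open S" "\<And>q. q \<in> S \<Longrightarrow> f q = h q"
  shows "smooth_on S f \<longleftrightarrow> smooth_on S h"
  using Ck_on_cong[OF assms] by (simp add: smooth_on_def)

lemma smooth_on_differentiable: "smooth_on S f \<Longrightarrow> p \<in> S \<Longrightarrow> f differentiable (at p)"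
  by (metis Ck_on.simps(2) smooth_on_def)

lemma smooth_on_pd: "smooth_on S f \<Longrightarrow> smooth_on S (pd i f)"
  by (metis Ck_on.simps(2) smooth_on_def)

lemma smooth_on_const: "smooth_on S (\<lambda>q. c)"
  by (simp add: smooth_on_def Ck_on_const)

lemma smooth_on_add:
  "open S \<Longrightarrow> smooth_on S f \<Longrightarrow> smooth_on S h \<Longrightarrow> smooth_on S (\<lambda>q. f q + h q)"
  by (simp add: smooth_on_def Ck_on_add)

lemma smooth_on_mult:
  "open S \<Longrightarrow> smooth_on S f \<Longrightarrow> smooth_on S h \<Longrightarrow> smooth_on S (\<lambda>q. f q * h q)"
  by (simp add: smooth_on_def Ck_on_mult)

lemma smooth_on_minus: "open S \<Longrightarrow> smooth_on S f \<Longrightarrow> smooth_on S (\<lambda>q. - f q)"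
  using smooth_on_mult[OF _ smooth_on_const, of S f "-1"] by simp

lemma smooth_on_diff:
  "open S \<Longrightarrow> smooth_on S f \<Longrightarrow> smooth_on S h \<Longrightarrow> smooth_on S (\<lambda>q. f q - h q)"
  using smooth_on_add[OF _ _ smooth_on_minus, of S f h] by simp

lemma smooth_on_inverse:
  "open S \<Longrightarrow> smooth_on S f \<Longrightarrow> (\<And>q. q \<in> S \<Longrightarrow> f q \<noteq> 0) \<Longrightarrow> smooth_on S (\<lambda>q. inverse (f q))"
  by (simp add: smooth_on_def Ck_on_inverse)

lemma smooth_on_sum:
  assumes "open S" "\<And>i. i \<in> K \<Longrightarrow> smooth_on S (f i)"
  shows "smooth_on S (\<lambda>q. \<Sum>i\<in>K. f i q)"
  using assms(2)
  by (induction K rule: infinite_finite_induct) (auto intro: smooth_on_add smooth_on_const assms(1))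

lemma smooth_on_prod:
  assumes "open S" "\<And>i. i \<in> K \<Longrightarrow> smooth_on S (f i)"
  shows "smooth_on S (\<lambda>q. \<Prod>i\<in>K. f i q)"
  using assms(2)
  by (induction K rule: infinite_finite_induct) (auto intro: smooth_on_mult smooth_on_const assms(1))

lemmas smooth_on_intros =
  smooth_on_const smooth_on_add smooth_on_mult smooth_on_minus smooth_on_diff smooth_on_sum smooth_on_prod

section \<open>Smooth matrix fields\<close>

text \<open>As \<open>smooth_matrix\<close>, but without tying the size of the matrices to the dimension of the chart.\<close>

definition smooth_entries :: "(real^'k::finite) set \<Rightarrow> (real^'k \<Rightarrow> real^'n^'m) \<Rightarrow> bool" where
  "smooth_entries S A \<longleftrightarrow> (\<forall>i j. smooth_on S (\<lambda>p. A p $ i $ j))"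

lemma smooth_matrix_iff: "smooth_matrix S A \<longleftrightarrow> smooth_entries S A"
  by (simp add: smooth_matrix_def smooth_entries_def)

lemma smooth_entriesD: "smooth_entries S T \<Longrightarrow> smooth_on S (\<lambda>q. T q $ i $ j)"
  by (simp add: smooth_entries_def)

lemma smooth_entries_mult:
  assumes "open S" "smooth_entries S A" "smooth_entries S B"
  shows "smooth_entries S (\<lambda>q. A q ** B q)"
  using assms by (auto simp: smooth_entries_def matrix_matrix_mult_def intro!: smooth_on_intros)

lemma smooth_on_det:
  assumes "open S" "smooth_entries S A"
  shows "smooth_on S (\<lambda>q. det (A q))"
  unfolding det_def using assms by (auto simp: smooth_entries_def intro!: smooth_on_intros)

lemma smooth_on_trace:
  assumes "open S" "smooth_entries S A"
  shows "smooth_on S (\<lambda>q. trace (A q))"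
  unfolding trace_def using assms by (auto simp: smooth_entries_def intro!: smooth_on_intros)

lemma smooth_entries_adjugate:
  assumes "open S" "smooth_entries S A"
  shows "smooth_entries S (\<lambda>q. adjugate (A q))"
proof -
  have "smooth_entries S (\<lambda>q. \<chi> k l. if l = i then axis j 1 $ k else A q $ k $ l)" for i j
    unfolding smooth_entries_def
  proof (intro allI)
    fix k l
    show "smooth_on S (\<lambda>q. (\<chi> k l. if l = i then axis j 1 $ k else A q $ k $ l) $ k $ l)"
      using assms(2) by (cases "l = i") (simp_all add: smooth_entries_def smooth_on_const)
  qed
  then have "smooth_on S (\<lambda>q. adjugate (A q) $ i $ j)" for i j
    unfolding adjugate_def by (simp add: smooth_on_det[OF assms(1)])
  then show ?thesis by (simp add: smooth_entries_def)
qed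

lemma smooth_form_vector_matrix_mult:
  assumes "open S" "smooth_form S \<rho>" "smooth_entries S A"
  shows "smooth_form S (\<lambda>q. \<rho> q v* A q)"
  using assms
  by (auto simp: smooth_form_def smooth_entries_def vector_matrix_mult_def intro!: smooth_on_intros)

lemma smooth_form_d0: "smooth_on S f \<Longrightarrow> smooth_form S (d0 f)"
  by (simp add: smooth_form_def d0_def smooth_on_pd)

section \<open>Restriction to coordinate lines and symmetry of second derivatives\<close>

lemma has_real_derivative_along_axis:
  assumes "f differentiable (at (p + s *\<^sub>R axis i 1))"
  shows "((\<lambda>s. f (p + s *\<^sub>R axis i 1)) has_real_derivative pd i f (p + s *\<^sub>R axis i 1)) (at s)"
proof -
  let ?f' = "frechet_derivative f (at (p + s *\<^sub>R axis i 1))"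
  have f': "(f has_derivative ?f') (at (p + s *\<^sub>R axis i 1))"
    using assms frechet_derivative_works by blast
  have "((\<lambda>s. p + s *\<^sub>R axis i 1) has_derivative (\<lambda>s. s *\<^sub>R axis i 1)) (at s)"
    by (auto intro!: derivative_eq_intros)
  from has_derivative_compose[OF this f']
  have "((\<lambda>s. f (p + s *\<^sub>R axis i 1)) has_derivative (\<lambda>s. ?f' (s *\<^sub>R axis i 1))) (at s)" .
  moreover have "?f' (t *\<^sub>R axis i 1) = t * pd i f (p + s *\<^sub>R axis i 1)" for t
    using linear_scale[OF has_derivative_linear[OF f']] by (simp add: pd_def)
  ultimately show ?thesis by (simp add: has_field_derivative_def mult_commute_abs)
qed

text \<open>The line through \<open>p\<close> may meet \<open>S\<close> in several pieces, but its
  preimage \<open>?T\<close> is an open set of reals around 0, and the derivative at 0 is a local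
  matter. This turns the independence conditions of adapted coordinates into vanishing partial
  derivatives.\<close>

lemma pd_eq_0_if_const_along_axis:
  assumes "open S" "p \<in> S" "f differentiable (at p)"
    and c: "\<And>s. p + s *\<^sub>R axis i 1 \<in> S \<Longrightarrow> f (p + s *\<^sub>R axis i 1) = f p"
  shows "pd i f p = 0"
proof -
  let ?T = "(\<lambda>s. p + s *\<^sub>R axis i (1::real)) -` S"
  have "open ?T"
    by (intro continuous_open_vimage assms(1)) (auto intro!: continuous_intros)
  moreover have "0 \<in> ?T" using assms(2) by simp
  moreover have "((\<lambda>s. f (p + s *\<^sub>R axis i 1)) has_real_derivative pd i f p) (at 0)"
    using has_real_derivative_along_axis[of f p 0 i] assms(3) by simp
  ultimately have "((\<lambda>s. f p) has_real_derivative pd i f p) (at 0)"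
    using has_field_derivative_transform_within_open[of _ _ 0 ?T "\<lambda>s. f p"] c by simp
  then show ?thesis using DERIV_const DERIV_unique by blast
qed

text \<open>The two sides are the mixed second difference quotient, evaluated by the mean value theorem.\<close>

lemma mixed_second_difference:
  fixes f :: "real^'k::finite \<Rightarrow> real"
  assumes "r > 0" "cball p (2 * r) \<subseteq> S" "Ck_on 2 S f"
  shows "\<exists>q\<in>cball p (2 * r). f (p + r *\<^sub>R axis i 1 + r *\<^sub>R axis j 1) - f (p + r *\<^sub>R axis i 1)
      - f (p + r *\<^sub>R axis j 1) + f p = r * r * pd j (pd i f) q"
proof -
  have diff: "f differentiable (at q)" "pd i f differentiable (at q)" if "q \<in> S" for q
    using assms(3) that by (simp_all add: numeral_2_eq_2)
  \<comment> \<open>The radius \<open>2 * r\<close> accommodates two successive displacements of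
    length at most \<open>r\<close>.\<close>
  have mem: "p + s *\<^sub>R axis i 1 + t *\<^sub>R axis j 1 \<in> cball p (2 * r)"
    if "0 \<le> s" "s \<le> r" "0 \<le> t" "t \<le> r" for s t
  proof -
    have "norm (s *\<^sub>R axis i 1 + t *\<^sub>R axis j (1::real)) \<le> s + t"
      using norm_triangle_ineq[of "s *\<^sub>R axis i 1" "t *\<^sub>R axis j (1::real)"] that
      by (simp add: norm_axis_1)
    then show ?thesis using that
      by (simp add: dist_norm add.assoc flip: norm_minus_cancel[of "_ + _ :: real^'k"])
  qed
  then have memS: "p + s *\<^sub>R axis i 1 + t *\<^sub>R axis j 1 \<in> S"
    if "0 \<le> s" "s \<le> r" "0 \<le> t" "t \<le> r" for s t
    using assms(2) that by blast
  \<comment> \<open>The difference in direction \<open>j\<close>, as a function of the displacement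
    in direction \<open>i\<close>. The mean value theorem is applied first to \<open>u\<close> and
    then to \<open>pd i f\<close> along direction \<open>j\<close>.\<close>
  define u where "u s = f (p + r *\<^sub>R axis j 1 + s *\<^sub>R axis i 1) - f (p + s *\<^sub>R axis i 1)" for s
  have "(u has_real_derivative
      pd i f (p + r *\<^sub>R axis j 1 + s *\<^sub>R axis i 1) - pd i f (p + s *\<^sub>R axis i 1)) (at s)"
    if "0 \<le> s" "s \<le> r" for s
    unfolding u_def
    using memS[of s r] memS[of s 0] that assms(1)
    by (intro DERIV_diff has_real_derivative_along_axis diff) (auto simp: algebra_simps)
  from MVT2[OF assms(1) this] obtain s where s: "0 < s" "s < r"
    and us: "u r - u 0 = r * (pd i f (p + r *\<^sub>R axis j 1 + s *\<^sub>R axis i 1) - pd i f (p + s *\<^sub>R axis i 1))"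
    by auto
  have "((\<lambda>t. pd i f (p + s *\<^sub>R axis i 1 + t *\<^sub>R axis j 1)) has_real_derivative
      pd j (pd i f) (p + s *\<^sub>R axis i 1 + t *\<^sub>R axis j 1)) (at t)"
    if "0 \<le> t" "t \<le> r" for t
    using memS[of s t] that s by (intro has_real_derivative_along_axis diff) auto
  from MVT2[OF assms(1) this] obtain t where t: "0 < t" "t < r"
    and ts: "pd i f (p + s *\<^sub>R axis i 1 + r *\<^sub>R axis j 1) - pd i f (p + s *\<^sub>R axis i 1)
        = r * pd j (pd i f) (p + s *\<^sub>R axis i 1 + t *\<^sub>R axis j 1)"
    by auto
  show ?thesis
  proof (rule bexI)
    show "p + s *\<^sub>R axis i 1 + t *\<^sub>R axis j 1 \<in> cball p (2 * r)"
      using s t by (intro mem) auto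
    show "f (p + r *\<^sub>R axis i 1 + r *\<^sub>R axis j 1) - f (p + r *\<^sub>R axis i 1)
      - f (p + r *\<^sub>R axis j 1) + f p = r * r * pd j (pd i f) (p + s *\<^sub>R axis i 1 + t *\<^sub>R axis j 1)"
      using us ts by (simp add: u_def add.commute add.left_commute)
  qed
qed

text \<open>Schwarz's theorem. The second difference is symmetric in the two directions, so the two
  mixed derivatives take a common value at points \<open>q1\<close> and \<open>q2\<close>
  arbitrarily close to \<open>p\<close>; continuity at \<open>p\<close> then excludes a gap.\<close>

lemma pd_commute:
  fixes f :: "real^'k::finite \<Rightarrow> real"
  assumes "open S" "Ck_on 2 S f" "p \<in> S"
  shows "pd i (pd j f) p = pd j (pd i f) p"
proof (rule ccontr)
  assume ne: "pd i (pd j f) p \<noteq> pd j (pd i f) p"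
  \<comment> \<open>Half the gap, so that two errors below \<open>e\<close> cannot bridge
    it.\<close>
  define e where "e = \<bar>pd i (pd j f) p - pd j (pd i f) p\<bar> / 2"
  have e: "e > 0" using ne by (simp add: e_def)
  have cont: "isCont (pd k (pd l f)) p" for k l
    using assms by (simp add: numeral_2_eq_2 continuous_on_eq_continuous_at)
  obtain d1 where d1: "d1 > 0" "\<And>q. dist q p < d1 \<Longrightarrow> dist (pd i (pd j f) q) (pd i (pd j f) p) < e"
    using cont[of i j] e unfolding continuous_at_eps_delta by blast
  obtain d2 where d2: "d2 > 0" "\<And>q. dist q p < d2 \<Longrightarrow> dist (pd j (pd i f) q) (pd j (pd i f) p) < e"
    using cont[of j i] e unfolding continuous_at_eps_delta by blast
  obtain d3 where d3: "d3 > 0" "ball p d3 \<subseteq> S"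
    using assms(1,3) openE by blast
  \<comment> \<open>Division by 4 leaves room for the closed ball of radius \<open>2 * r\<close>
    inside all three open balls.\<close>
  define r where "r = min d1 (min d2 d3) / 4"
  have r: "r > 0" "2 * r < d1" "2 * r < d2" "2 * r < d3"
    using d1(1) d2(1) d3(1) by (auto simp: r_def)
  have S: "cball p (2 * r) \<subseteq> S" using d3(2) r by auto
  obtain q1 where q1: "q1 \<in> cball p (2 * r)" "f (p + r *\<^sub>R axis i 1 + r *\<^sub>R axis j 1) - f (p + r *\<^sub>R axis i 1)
      - f (p + r *\<^sub>R axis j 1) + f p = r * r * pd j (pd i f) q1"
    using mixed_second_difference[OF r(1) S assms(2)] by blast
  obtain q2 where q2: "q2 \<in> cball p (2 * r)" "f (p + r *\<^sub>R axis j 1 + r *\<^sub>R axis i 1) - f (p + r *\<^sub>R axis j 1)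
      - f (p + r *\<^sub>R axis i 1) + f p = r * r * pd i (pd j f) q2"
    using mixed_second_difference[OF r(1) S assms(2)] by blast
  have "r * r * pd j (pd i f) q1 = r * r * pd i (pd j f) q2"
    unfolding q1(2)[symmetric] q2(2)[symmetric] by (simp add: algebra_simps)
  then have "pd j (pd i f) q1 = pd i (pd j f) q2" using r(1) by simp
  moreover have "dist (pd i (pd j f) q2) (pd i (pd j f) p) < e"
    using q2(1) r by (intro d1(2)) (simp add: dist_commute)
  moreover have "dist (pd j (pd i f) q1) (pd j (pd i f) p) < e"
    using q1(1) r by (intro d2(2)) (simp add: dist_commute)
  ultimately show False unfolding e_def dist_real_def by argo
qed

lemma d1_d0:
  assumes "open S" "smooth_on S f" "p \<in> S"
  shows "d1 (d0 f) p = 0"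
proof -
  have "Ck_on 2 S f" using assms(2) by (simp add: smooth_on_def)
  from pd_commute[OF assms(1) this assms(3)] show ?thesis
    by (simp add: d1_def d0_def vec_eq_iff)
qed

section \<open>Matrix inverses and the derivative of a determinant\<close>

lemma matrix_inv_right: "invertible (A :: real^'n^'n) \<Longrightarrow> A ** matrix_inv A = mat 1"
  and matrix_inv_left: "invertible (A :: real^'n^'n) \<Longrightarrow> matrix_inv A ** A = mat 1"
  using someI_ex[of "\<lambda>B. A ** B = mat 1 \<and> B ** A = mat 1"]
  by (auto simp: invertible_def matrix_inv_def)

lemma matrix_inv_eqI:
  fixes A B :: "real^'n^'n"
  assumes "A ** B = mat 1"
  shows "matrix_inv A = B"
proof -
  have "invertible A" using assms matrix_left_right_inverse unfolding invertible_def by blast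
  then show ?thesis
    by (metis assms matrix_inv_left matrix_mul_assoc matrix_mul_lid matrix_mul_rid)
qed

text \<open>Cramer's rule. It exhibits the entries of the inverse as polynomials in those of
  \<open>A\<close> divided by \<open>det A\<close>, from which their smoothness is obtained.\<close>

lemma matrix_inv_eq_adjugate:
  fixes A :: "real^'n::finite^'n"
  assumes "invertible A"
  shows "matrix_inv A = inverse (det A) *\<^sub>R adjugate A"
proof -
  have "det A \<noteq> 0" using assms invertible_det_nz by blast
  then show ?thesis
    using adjugate_mult_right[OF assms] by (intro matrix_inv_eqI) (simp add: matrix_scalar_ac flip: scalar_matrix_assoc)
qed

lemma invertible_matrix_inv: "invertible (A :: real^'n^'n) \<Longrightarrow> invertible (matrix_inv A)"
  unfolding invertible_def by (metis invertible_def matrix_inv_left matrix_inv_right)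

lemma matrix_inv_matrix_inv: "invertible (A :: real^'n^'n) \<Longrightarrow> matrix_inv (matrix_inv A) = A"
  by (intro matrix_inv_eqI) (rule matrix_inv_left)

lemma matrix_inv_scaleR:
  fixes A :: "real^'n^'n"
  assumes "invertible A" "c \<noteq> 0"
  shows "matrix_inv (c *\<^sub>R A) = inverse c *\<^sub>R matrix_inv A"
  using assms by (intro matrix_inv_eqI) (simp add: matrix_scalar_ac matrix_inv_right flip: scalar_matrix_assoc)

lemma pd_prod:
  assumes "\<And>i. i \<in> I \<Longrightarrow> f i differentiable (at p)"
  shows "pd c (\<lambda>q. \<Prod>i\<in>I. f i q) p = (\<Sum>i\<in>I. pd c (f i) p * (\<Prod>j\<in>I - {i}. f j p))"
proof -
  have "((\<lambda>q. \<Prod>i\<in>I. f i q) has_derivative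
      (\<lambda>y. \<Sum>i\<in>I. frechet_derivative (f i) (at p) y * (\<Prod>j\<in>I - {i}. f j p))) (at p)"
    using assms by (intro has_derivative_prod) (simp add: frechet_derivative_works)
  from frechet_derivative_at[OF this, symmetric] show ?thesis by (simp add: pd_def)
qed

lemma differentiable_prod:
  fixes f :: "'i \<Rightarrow> 'a::real_normed_vector \<Rightarrow> real"
  assumes "\<And>i. i \<in> I \<Longrightarrow> f i differentiable (at p)"
  shows "(\<lambda>q. \<Prod>i\<in>I. f i q) differentiable (at p)"
  using assms by (induction I rule: infinite_finite_induct) auto

text \<open>Jacobi's formula. Differentiating the Leibniz expansion factor by factor gives, for each
  \<open>i\<close>, the determinant with column \<open>i\<close> replaced by its derivative, and
  \<open>adjugate_mult_vec\<close> evaluates it.\<close>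

lemma pd_det:
  fixes A :: "real^'k::finite \<Rightarrow> real^'n::finite^'n"
  assumes "\<And>i j. (\<lambda>q. A q $ i $ j) differentiable (at p)"
  shows "pd c (\<lambda>q. det (A q)) p = trace (adjugate (A p) ** (\<chi> i j. pd c (\<lambda>q. A q $ i $ j) p))"
proof -
  let ?P = "{\<sigma>. \<sigma> permutes (UNIV :: 'n set)}"
  let ?A' = "\<chi> i j. pd c (\<lambda>q. A q $ i $ j) p"
  \<comment> \<open>In this form the product runs over columns, matching the column replacement in
    \<open>adjugate\<close>.\<close>
  have det_col: "det B = (\<Sum>\<sigma>\<in>?P. of_int (sign \<sigma>) * (\<Prod>i\<in>UNIV. B $ \<sigma> i $ i))" for B :: "real^'n^'n"
    using det_transpose[of B] by (simp add: det_def transpose_def)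
  have "pd c (\<lambda>q. det (A q)) p = (\<Sum>\<sigma>\<in>?P. of_int (sign \<sigma>) *
      (\<Sum>i\<in>UNIV. ?A' $ \<sigma> i $ i * (\<Prod>j\<in>UNIV - {i}. A p $ \<sigma> j $ j)))"
    unfolding det_col
    by (subst pd_sum) (simp_all add: assms pd_cmult pd_prod differentiable_prod)
  also have "\<dots> = (\<Sum>i\<in>UNIV. \<Sum>\<sigma>\<in>?P. of_int (sign \<sigma>) *
      (?A' $ \<sigma> i $ i * (\<Prod>j\<in>UNIV - {i}. A p $ \<sigma> j $ j)))"
    by (simp only: sum_distrib_left) (rule sum.swap)
  also have "\<dots> = (\<Sum>i\<in>UNIV. det (\<chi> k l. if l = i then column i ?A' $ k else A p $ k $ l))"
  proof (rule sum.cong[OF refl])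
    fix i :: 'n
    have "(\<Prod>j\<in>UNIV. (\<chi> k l. if l = i then column i ?A' $ k else A p $ k $ l) $ \<sigma> j $ j)
        = ?A' $ \<sigma> i $ i * (\<Prod>j\<in>UNIV - {i}. A p $ \<sigma> j $ j)" for \<sigma>
      by (subst prod.remove[of UNIV i]) (auto simp: column_def intro!: prod.cong)
    then show "(\<Sum>\<sigma>\<in>?P. of_int (sign \<sigma>) * (?A' $ \<sigma> i $ i * (\<Prod>j\<in>UNIV - {i}. A p $ \<sigma> j $ j)))
        = det (\<chi> k l. if l = i then column i ?A' $ k else A p $ k $ l)"
      by (simp only: det_col)
  qed
  also have "\<dots> = (\<Sum>i\<in>UNIV. (adjugate (A p) *v column i ?A') $ i)"
    by (simp only: adjugate_mult_vec)
  also have "\<dots> = trace (adjugate (A p) ** ?A')"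
    by (simp add: trace_def matrix_matrix_mult_def matrix_vector_mult_def column_def)
  finally show ?thesis .
qed

section \<open>Enlarging a matrix by an identity block\<close>

text \<open>The direct sum of \<open>A\<close> with an identity matrix, along an arbitrary injection
  of index types. The choices \<open>Inl\<close> and \<open>Inr\<close> give the two commuting
  factors of a block diagonal matrix, so one determinant computation serves both.\<close>

definition embed_matrix :: "('a::finite \<Rightarrow> 'b::finite) \<Rightarrow> real^'a^'a \<Rightarrow> real^'b^'b" where
  "embed_matrix f A = (\<chi> k l. if k \<in> range f \<and> l \<in> range f then A $ inv f k $ inv f l else of_bool (k = l))"

lemma embed_matrix_mult:
  assumes "inj f"
  shows "embed_matrix f (A ** B) = embed_matrix f A ** embed_matrix f B"
proof -
  have "(embed_matrix f A ** embed_matrix f B) $ k $ l = embed_matrix f (A ** B) $ k $ l" for k l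
  proof (cases "k \<in> range f")
    case True
    then obtain i where i: "k = f i" by blast
    have "(embed_matrix f A ** embed_matrix f B) $ k $ l
        = (\<Sum>r\<in>range f. embed_matrix f A $ k $ r * embed_matrix f B $ r $ l)"
      unfolding matrix_matrix_mult_def
      by (simp, intro sum.mono_neutral_right) (auto simp: embed_matrix_def i)
    also have "\<dots> = (\<Sum>j\<in>UNIV. A $ i $ j * embed_matrix f B $ f j $ l)"
      using assms by (simp add: sum.reindex embed_matrix_def i)
    also have "\<dots> = embed_matrix f (A ** B) $ k $ l"
      using assms by (auto simp: embed_matrix_def matrix_matrix_mult_def i intro!: sum.neutral)
    finally show ?thesis .
  next
    case False
    then have "(embed_matrix f A ** embed_matrix f B) $ k $ l
        = (\<Sum>r\<in>UNIV. if r = k then embed_matrix f B $ k $ l else 0)"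
      unfolding matrix_matrix_mult_def vec_lambda_beta
      by (intro sum.cong) (auto simp: embed_matrix_def)
    then show ?thesis using False by (simp add: embed_matrix_def)
  qed
  then show ?thesis by (simp add: vec_eq_iff)
qed

text \<open>Multiplicativity reduces the claim to matrices with a zero row, diagonal matrices,
  transpositions and transvections, and embedding turns each into one of the same kind.\<close>

lemma det_embed_matrix:
  fixes f :: "'a::finite \<Rightarrow> 'b::finite"
  assumes f: "inj f"
  shows "det (embed_matrix f A) = det A"
proof (induction A rule: induct_matrix_elementary)
  case (1 A B)
  then show ?case by (simp add: embed_matrix_mult f det_mul)
next
  case (2 A i)
  then have "row (f i) (embed_matrix f A) = 0"
    using f by (auto simp: row_def vec_eq_iff embed_matrix_def)
  then show ?case using 2 by (metis det_zero_row(2) row_def)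
next
  case (3 A)
  have "det (embed_matrix f A) = (\<Prod>k\<in>UNIV. embed_matrix f A $ k $ k)"
    using 3 f by (intro det_diagonal) (auto simp: embed_matrix_def inv_f_f intro!: 3)
  also have "\<dots> = (\<Prod>k\<in>range f. embed_matrix f A $ k $ k)"
    by (intro prod.mono_neutral_right) (auto simp: embed_matrix_def)
  also have "\<dots> = (\<Prod>i\<in>UNIV. A $ i $ i)"
    using f by (simp add: prod.reindex embed_matrix_def)
  finally show ?case using 3 by (simp add: det_diagonal)
next
  case (4 m n)
  \<comment> \<open>The index type is left general because the fact is applied both to the matrix
    and to its embedding.\<close>
  have swap: "det (\<chi> i j. mat 1 $ i $ Transposition.transpose m n j :: real^'c^'c) = - 1"
    if "m \<noteq> n" for m n :: "'c::finite"
    using that by (subst det_permute_columns) (auto simp: sign_swap_id permutes_swap_id)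
  have "embed_matrix f (\<chi> i j. mat 1 $ i $ Transposition.transpose m n j)
      = (\<chi> i j. mat 1 $ i $ Transposition.transpose (f m) (f n) j)"
  proof -
    have T: "Transposition.transpose (f m) (f n) (f j) = f (Transposition.transpose m n j)" for j
      using f by (simp add: Transposition.transpose_def inj_eq)
    have T': "Transposition.transpose (f m) (f n) k = k" if "k \<notin> range f" for k
      using that by (auto simp: Transposition.transpose_def)
    have "embed_matrix f (\<chi> i j. mat 1 $ i $ Transposition.transpose m n j) $ k $ l
        = mat 1 $ k $ Transposition.transpose (f m) (f n) l" for k l
      using f by (cases "k \<in> range f"; cases "l \<in> range f")
        (auto simp: embed_matrix_def mat_def T T' inj_eq)
    then show ?thesis by (simp add: vec_eq_iff)
  qed
  then show ?case using 4 f by (simp add: swap inj_eq)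
next
  case (5 m n c)
  have idplus: "det (\<chi> i j. if i = m \<and> j = n then c else of_bool (i = j)) = 1"
    if "m \<noteq> n" for m n :: "'c::finite"
  proof -
    have "(\<chi> i j. if i = m \<and> j = n then c else of_bool (i = j))
        = (\<chi> k. if k = m then row m (mat 1) + c *s row n (mat 1) else row k (mat 1))"
      using that by (auto simp: vec_eq_iff row_def mat_def)
    then show ?thesis using det_row_operation[OF that, of "mat 1" c] by simp
  qed
  have "embed_matrix f (\<chi> i j. if i = m \<and> j = n then c else of_bool (i = j))
      = (\<chi> i j. if i = f m \<and> j = f n then c else of_bool (i = j))"
    using f by (auto simp: vec_eq_iff embed_matrix_def inj_eq)
  then show ?case using 5 f by (simp add: idplus inj_eq)
qed

section \<open>Block matrices and their determinants\<close>

definition blocks :: "real^'m^'m \<Rightarrow> real^'n^'m \<Rightarrow> real^'m^'n \<Rightarrow> real^'n^'n \<Rightarrow>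
    real^('m::finite + 'n::finite)^('m + 'n)" where
  "blocks A B C D = (\<chi> k l. case k of
      Inl i \<Rightarrow> (case l of Inl j \<Rightarrow> A $ i $ j | Inr b \<Rightarrow> B $ i $ b)
    | Inr a \<Rightarrow> (case l of Inl j \<Rightarrow> C $ a $ j | Inr b \<Rightarrow> D $ a $ b))"

lemma sum_UNIV_sum:
  "(\<Sum>k\<in>(UNIV :: ('m::finite + 'n::finite) set). f k) = (\<Sum>i\<in>UNIV. f (Inl i)) + (\<Sum>a\<in>UNIV. f (Inr a))"
  by (simp only: UNIV_Plus_UNIV[symmetric] sum.Plus[OF finite finite] o_def)

lemma blocks_nth [simp]:
  "blocks A B C D $ Inl i $ Inl j = A $ i $ j"
  "blocks A B C D $ Inl i $ Inr b = B $ i $ b"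
  "blocks A B C D $ Inr a $ Inl j = C $ a $ j"
  "blocks A B C D $ Inr a $ Inr b = D $ a $ b"
  by (simp_all add: blocks_def)

lemma all_sum: "(\<forall>k::'m + 'n. P k) \<longleftrightarrow> (\<forall>i. P (Inl i)) \<and> (\<forall>a. P (Inr a))"
  by (metis sum.exhaust)

lemma blocks_eqI:
  "block11 M = block11 N \<Longrightarrow> block12 M = block12 N \<Longrightarrow> block21 M = block21 N \<Longrightarrow> block22 M = block22 N
    \<Longrightarrow> M = N"
  by (auto simp: vec_eq_iff all_sum block11_def block12_def block21_def block22_def)

lemma block_blocks [simp]:
  "block11 (blocks A B C D) = A" "block12 (blocks A B C D) = B"
  "block21 (blocks A B C D) = C" "block22 (blocks A B C D) = D"
  by (simp_all add: block11_def block12_def block21_def block22_def vec_eq_iff)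

lemma blocks_block: "blocks (block11 M) (block12 M) (block21 M) (block22 M) = M"
  by (rule blocks_eqI) simp_all

lemma block_mult:
  "block11 (M ** N) = block11 M ** block11 N + block12 M ** block21 N"
  "block12 (M ** N) = block11 M ** block12 N + block12 M ** block22 N"
  "block21 (M ** N) = block21 M ** block11 N + block22 M ** block21 N"
  "block22 (M ** N) = block21 M ** block12 N + block22 M ** block22 N"
  by (simp_all add: block11_def block12_def block21_def block22_def vec_eq_iff
      matrix_matrix_mult_def sum_UNIV_sum)

lemma block_mat [simp]:
  "block11 (mat c) = mat c" "block12 (mat c) = 0" "block21 (mat c) = 0" "block22 (mat c) = mat c"
  by (simp_all add: block11_def block12_def block21_def block22_def vec_eq_iff mat_def)

lemma block_transpose:
  "block11 (transpose M) = transpose (block11 M)" "block12 (transpose M) = transpose (block21 M)"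
  "block21 (transpose M) = transpose (block12 M)" "block22 (transpose M) = transpose (block22 M)"
  by (simp_all add: block11_def block12_def block21_def block22_def vec_eq_iff transpose_def)

lemma block_scaleR:
  "block11 (c *\<^sub>R M) = c *\<^sub>R block11 M" "block12 (c *\<^sub>R M) = c *\<^sub>R block12 M"
  "block21 (c *\<^sub>R M) = c *\<^sub>R block21 M" "block22 (c *\<^sub>R M) = c *\<^sub>R block22 M"
  by (simp_all add: block11_def block12_def block21_def block22_def vec_eq_iff)

lemma det_blocks_diagonal:
  fixes A :: "real^'m::finite^'m" and D :: "real^'n::finite^'n"
  shows "det (blocks A 0 0 D) = det A * det D"
proof -
  have A: "embed_matrix Inl A = blocks A 0 0 (mat 1 :: real^'n^'n)"
    by (auto simp: vec_eq_iff all_sum embed_matrix_def mat_def inv_f_f)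
  have D: "embed_matrix Inr D = blocks (mat 1 :: real^'m^'m) 0 0 D"
    by (auto simp: vec_eq_iff all_sum embed_matrix_def mat_def inv_f_f)
  have "blocks A 0 0 D = embed_matrix Inl A ** embed_matrix Inr D"
    unfolding A D by (rule blocks_eqI) (simp_all add: block_mult)
  then show ?thesis by (simp add: det_mul det_embed_matrix)
qed

text \<open>
  Conjugating a unitriangular block matrix with off-diagonal block \<open>C\<close> by a block scalar matrix
  turns \<open>C\<close> into \<open>2 C\<close>, and so does squaring it; hence its determinant is idempotent.
\<close>

lemma det_blocks_unitriangular:
  fixes C :: "real^'m::finite^'n::finite"
  shows "det (blocks (mat 1) 0 C (mat 1)) = 1"
proof -
  let ?E = "\<lambda>C :: real^'m^'n. blocks (mat 1) 0 C (mat 1)"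
  let ?S = "\<lambda>c. blocks (mat 1 :: real^'m^'m) 0 0 (c *\<^sub>R mat 1 :: real^'n^'n)"
  have mult: "?E C ** ?E C' = ?E (C + C')" for C C'
    by (rule blocks_eqI) (simp_all add: block_mult)
  have "?S c ** ?E C ** ?S (1/c) = ?E (c *\<^sub>R C)" if "c \<noteq> 0" for c
    using that by (intro blocks_eqI) (simp_all add: block_mult scalar_matrix_assoc[symmetric] matrix_scalar_ac)
  from this[of 2, OF zero_neq_numeral[symmetric]] have "?S 2 ** ?E C ** ?S (1/2) = ?E (C + C)"
    by (simp only: scaleR_2 simp_thms)
  from arg_cong[OF this, of det] have "det (?E (C + C)) = (det (?S 2) * det (?S (1/2))) * det (?E C)"
    by (simp only: det_mul ac_simps)
  moreover have "?S 2 ** ?S (1/2) = mat 1"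
    by (rule blocks_eqI) (simp_all add: block_mult scalar_matrix_assoc[symmetric] matrix_scalar_ac)
  then have "det (?S 2) * det (?S (1/2)) = 1"
    by (metis det_I det_mul)
  ultimately have "det (?E (C + C)) = det (?E C)"
    by (simp only: mult_1)
  then have "det (?E C) * det (?E C) = det (?E C)"
    by (simp flip: det_mul add: mult)
  moreover have "?E C ** ?E (- C) = mat 1"
    by (rule blocks_eqI) (simp_all add: block_mult)
  then have "det (?E C) \<noteq> 0"
    by (metis det_I det_mul mult_zero_left zero_neq_one)
  ultimately show ?thesis by simp
qed

lemma det_blocks_unitriangular':
  fixes B :: "real^'n::finite^'m::finite"
  shows "det (blocks (mat 1) B 0 (mat 1)) = 1"
proof -
  have "transpose (blocks (mat 1) 0 (transpose B) (mat 1)) = blocks (mat 1) B 0 (mat 1)"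
    by (rule blocks_eqI) (simp_all add: block_transpose transpose_mat transpose_transpose, simp add: transpose_def vec_eq_iff)
  then show ?thesis by (metis det_transpose det_blocks_unitriangular)
qed

section \<open>Schur complements and adjugates\<close>

definition schur_complement :: "real^('m::finite + 'n::finite)^('m + 'n) \<Rightarrow> real^'n^'n" where
  "schur_complement M = block22 M - block21 M ** matrix_inv (block11 M) ** block12 M"

lemma matrix_mult_minus_right: "A ** (- B) = - (A ** B)"
  for A :: "real^'n^'m" and B :: "real^'k^'n"
  by (simp add: matrix_matrix_mult_def vec_eq_iff sum_negf)

text \<open>Block column elimination: multiples of the y-columns are added to the x-columns so as to
  clear the upper right block.\<close>

lemma mult_schur:
  assumes "invertible (block11 M)"
  shows "M ** blocks (mat 1) (- (matrix_inv (block11 M) ** block12 M)) 0 (mat 1)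
    = blocks (block11 M) 0 (block21 M) (schur_complement M)"
  by (rule blocks_eqI)
    (simp_all add: block_mult schur_complement_def matrix_mul_assoc matrix_inv_right[OF assms]
      matrix_mult_minus_right)

lemma det_schur:
  assumes "invertible (block11 M)"
  shows "det M = det (block11 M) * det (schur_complement M)"
proof -
  \<comment> \<open>The block triangular matrix left by the elimination splits further into a
    unitriangular and a block diagonal factor.\<close>
  have "blocks (block11 M) 0 (block21 M) (schur_complement M)
      = blocks (mat 1) 0 (block21 M ** matrix_inv (block11 M)) (mat 1) **
        blocks (block11 M) 0 0 (schur_complement M)"
    by (rule blocks_eqI) (simp_all add: block_mult matrix_inv_left[OF assms] flip: matrix_mul_assoc)
  then have "det (blocks (block11 M) 0 (block21 M) (schur_complement M))
      = det (block11 M) * det (schur_complement M)"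
    by (simp add: det_mul det_blocks_unitriangular det_blocks_diagonal)
  then show ?thesis
    unfolding mult_schur[OF assms, symmetric] by (simp add: det_mul det_blocks_unitriangular')
qed

text \<open>Multiplying \<open>mult_schur\<close> by \<open>adjugate M\<close> on the left leaves
  \<open>det M\<close> times the unitriangular factor, whose x-columns are the two right-hand sides.
  Singular \<open>M\<close> is covered, which matters since \<open>M + a *\<^sub>R P2\<close> can be
  singular for some \<open>a\<close>.\<close>

lemma adjugate_schur:
  assumes "invertible (block11 M)"
  shows "block12 (adjugate M) ** schur_complement M = det M *\<^sub>R (- (matrix_inv (block11 M) ** block12 M))"
    and "block22 (adjugate M) ** schur_complement M = det M *\<^sub>R mat 1"
proof -
  have "adjugate M ** blocks (block11 M) 0 (block21 M) (schur_complement M)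
      = det M *\<^sub>R blocks (mat 1) (- (matrix_inv (block11 M) ** block12 M)) 0 (mat 1)"
    unfolding mult_schur[OF assms, symmetric]
    by (simp add: matrix_mul_assoc adjugate_mult_left flip: scalar_matrix_assoc)
  from arg_cong[OF this, of block12] arg_cong[OF this, of block22]
  show "block12 (adjugate M) ** schur_complement M = det M *\<^sub>R (- (matrix_inv (block11 M) ** block12 M))"
    and "block22 (adjugate M) ** schur_complement M = det M *\<^sub>R mat 1"
    by (simp_all add: block_mult block_scaleR)
qed

section \<open>Leading coefficients of the pencil\<close>

text \<open>The substitution a = 1/e yields identities only for nonzero e; continuity carries them
  to e = 0.\<close>

lemma eq_at_0_if_continuous:
  fixes f h :: "real \<Rightarrow> real"
  assumes "isCont f 0" "isCont h 0" "\<And>e. e \<noteq> 0 \<Longrightarrow> f e = h e"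
  shows "f 0 = h 0"
proof -
  have "(f \<longlongrightarrow> f 0) (at 0)" "(h \<longlongrightarrow> h 0) (at 0)"
    using assms(1,2) by (auto simp: isCont_def)
  moreover have "(f \<longlongrightarrow> h 0) (at 0)"
    using calculation(2) by (rule Lim_transform_eventually) (simp add: assms(3) eventually_at_filter)
  ultimately show ?thesis using tendsto_unique by force
qed

lemma det_scaleR: "det (c *\<^sub>R (A :: real^'n::finite^'n)) = c ^ CARD('n) * det A"
  using det_rows_mul[of "\<lambda>_. c" "\<lambda>i. A $ i"] by (simp add: scaleR_vec_def scalar_mult_eq_scaleR)

text \<open>
  Comparison of the two leading coefficients in \<open>a\<close>, carried out at \<open>e = 0\<close> after substituting
  \<open>a = 1 / e\<close>.
\<close>

lemma leading_coefficients:
  fixes B :: "nat \<Rightarrow> real^'n::finite^'r::finite" and K :: "real^'n^'n"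
  assumes "\<And>a. (\<Sum>i = 1..CARD('n) + 1. a ^ (i - 1) *\<^sub>R B i) ** (K + a *\<^sub>R mat 1) = det (K + a *\<^sub>R mat 1) *\<^sub>R Z"
  shows "B CARD('n) = Z"
proof -
  let ?n = "CARD('n)"
  let ?T = "\<lambda>e. e *\<^sub>R K + mat 1"
  let ?F = "\<lambda>e. \<Sum>i = 1..?n + 1. e ^ (?n + 1 - i) *\<^sub>R B i"
  let ?G = "\<lambda>e. \<Sum>i = 1..?n. e ^ (?n - i) *\<^sub>R B i"
  \<comment> \<open>Multiplying the hypothesis at a = 1/e by e^(n+1) makes both sides polynomial in
    e. The factor e left over on the right makes the top coefficient vanish.\<close>
  have F: "?F e ** ?T e = (e * det (?T e)) *\<^sub>R Z" if "e \<noteq> 0" for e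
  proof -
    have T: "?T e = e *\<^sub>R (K + (1/e) *\<^sub>R mat 1)"
      using that by (simp add: scaleR_right_distrib)
    have Fe: "?F e = e ^ ?n *\<^sub>R (\<Sum>i = 1..?n + 1. (1/e) ^ (i - 1) *\<^sub>R B i)"
      unfolding scaleR_sum_right
    proof (intro sum.cong refl)
      fix i assume i: "i \<in> {1..?n + 1}"
      then have "e ^ ?n = e ^ (?n + 1 - i) * e ^ (i - 1)"
        by (simp flip: power_add)
      then show "e ^ (?n + 1 - i) *\<^sub>R B i = e ^ ?n *\<^sub>R (1/e) ^ (i - 1) *\<^sub>R B i"
        using that by (simp add: power_one_over)
    qed
    have "?F e ** ?T e = (e * e ^ ?n) *\<^sub>R
        ((\<Sum>i = 1..?n + 1. (1/e) ^ (i - 1) *\<^sub>R B i) ** (K + (1/e) *\<^sub>R mat 1))"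
      unfolding Fe T by (simp add: matrix_scalar_ac flip: scalar_matrix_assoc)
    also have "\<dots> = (e * (e ^ ?n * det (K + (1/e) *\<^sub>R mat 1))) *\<^sub>R Z"
      unfolding assms by simp
    also have "e ^ ?n * det (K + (1/e) *\<^sub>R mat 1) = det (?T e)"
      unfolding T det_scaleR by simp
    finally show ?thesis .
  qed
  have contT: "isCont (\<lambda>e. det (?T e)) 0"
    unfolding det_def by (intro continuous_intros)
  have "B (?n + 1) $ k $ l = 0" for k l
  proof -
    have "(?F 0 ** ?T 0) $ k $ l = ((0 * det (?T 0)) *\<^sub>R Z) $ k $ l"
    proof (rule eq_at_0_if_continuous)
      show "isCont (\<lambda>e. (?F e ** ?T e) $ k $ l) 0"
        by (simp only: matrix_matrix_mult_def vec_lambda_beta sum_component vector_add_component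
          vector_scaleR_component) (intro continuous_intros)
      show "isCont (\<lambda>e. ((e * det (?T e)) *\<^sub>R Z) $ k $ l) 0"
        by (simp, intro continuous_intros contT)
      show "(?F e ** ?T e) $ k $ l = ((e * det (?T e)) *\<^sub>R Z) $ k $ l" if "e \<noteq> 0" for e
        using F[OF that] by (simp only:)
    qed
    moreover
    \<comment> \<open>At e = 0 only the summand with exponent 0 survives, here i = n + 1.\<close>
    have "?F 0 = B (?n + 1)"
      by (subst sum.remove[of _ "?n + 1"]) (auto intro!: sum.neutral)
    then have "?F 0 ** ?T 0 = B (?n + 1)" by (simp only:) simp
    ultimately show ?thesis by (simp only: mult_zero_left scaleR_zero_left zero_index)
  qed
  then have B0: "B (?n + 1) = 0" by (simp add: vec_eq_iff)
  \<comment> \<open>As the top coefficient is zero, a factor e can be cancelled, and a second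
    evaluation at e = 0 reads off the next coefficient.\<close>
  have FG: "?F e = e *\<^sub>R ?G e" for e
    unfolding scaleR_sum_right using B0 by (simp add: Suc_diff_le)
  have G: "?G e ** ?T e = det (?T e) *\<^sub>R Z" if "e \<noteq> 0" for e
  proof -
    have "e *\<^sub>R (?G e ** ?T e) = e *\<^sub>R (det (?T e) *\<^sub>R Z)"
      using F[OF that] unfolding FG by (simp flip: scalar_matrix_assoc)
    then show ?thesis using that by (simp only: scaleR_cancel_left simp_thms)
  qed
  have "B ?n $ k $ l = Z $ k $ l" for k l
  proof -
    have "(?G 0 ** ?T 0) $ k $ l = (det (?T 0) *\<^sub>R Z) $ k $ l"
    proof (rule eq_at_0_if_continuous)
      show "isCont (\<lambda>e. (?G e ** ?T e) $ k $ l) 0"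
        by (simp only: matrix_matrix_mult_def vec_lambda_beta sum_component vector_add_component
          vector_scaleR_component) (intro continuous_intros)
      show "isCont (\<lambda>e. (det (?T e) *\<^sub>R Z) $ k $ l) 0"
        by (simp, intro continuous_intros contT)
      show "(?G e ** ?T e) $ k $ l = (det (?T e) *\<^sub>R Z) $ k $ l" if "e \<noteq> 0" for e
        using G[OF that] by (simp only:)
    qed
    moreover
    have "?G 0 = B ?n"
      by (subst sum.remove[of _ "?n"]) (auto intro!: sum.neutral simp: Suc_le_eq)
    then have "?G 0 ** ?T 0 = B ?n" by (simp only:) simp
    ultimately show ?thesis by (simp only: scaleR_zero_left add_0 det_I scaleR_one)
  qed
  then show ?thesis by (simp add: vec_eq_iff)
qed

text \<open>Only x-columns are compared, because the x-part of a covector times a matrix involves no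
  others.\<close>

lemma adjugate_pencil_coefficient:
  fixes M :: "real^('m::finite + 'n::finite)^('m + 'n)"
  assumes A: "\<And>a. adjugate (M + a *\<^sub>R P2) = (\<Sum>i = 1..CARD('n) + 1. a ^ (i - 1) *\<^sub>R A i)"
    and inv: "invertible M" "invertible (block11 M)"
  shows "block12 (A CARD('n)) ** adjugate (schur_complement M) = block12 (adjugate M)"
    and "block22 (A CARD('n)) ** adjugate (schur_complement M) = block22 (adjugate M)"
proof -
  let ?K = "schur_complement M"
  let ?L = "matrix_inv (block11 M) ** block12 M"
  \<comment> \<open>Adding a multiple of \<open>P2\<close> changes the lower right block alone, so
    the Schur complement is shifted by the same multiple of the identity.\<close>
  have blk: "block11 (M + a *\<^sub>R P2) = block11 M" "block12 (M + a *\<^sub>R P2) = block12 M"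
    "block21 (M + a *\<^sub>R P2) = block21 M" "block22 (M + a *\<^sub>R P2) = block22 M + a *\<^sub>R mat 1" for a
    by (auto simp: block11_def block12_def block21_def block22_def P2_def vec_eq_iff mat_def)
  have K: "schur_complement (M + a *\<^sub>R P2) = ?K + a *\<^sub>R mat 1" for a
    by (simp add: schur_complement_def blk)
  have detM: "det (M + a *\<^sub>R P2) = det (?K + a *\<^sub>R mat 1) * det (block11 M)" for a
    using det_schur[of "M + a *\<^sub>R P2"] inv(2) by (simp add: blk K)
  have "block12 (\<Sum>i\<in>I. c i *\<^sub>R A i) = (\<Sum>i\<in>I. c i *\<^sub>R block12 (A i))"
    "block22 (\<Sum>i\<in>I. c i *\<^sub>R A i) = (\<Sum>i\<in>I. c i *\<^sub>R block22 (A i))" for I and c :: "nat \<Rightarrow> real"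
    by (simp_all add: block12_def block22_def vec_eq_iff)
  note sums = this
  have p: "(\<Sum>i = 1..CARD('n) + 1. a ^ (i - 1) *\<^sub>R block12 (A i)) ** (?K + a *\<^sub>R mat 1)
      = det (?K + a *\<^sub>R mat 1) *\<^sub>R (det (block11 M) *\<^sub>R (- ?L))"
    "(\<Sum>i = 1..CARD('n) + 1. a ^ (i - 1) *\<^sub>R block22 (A i)) ** (?K + a *\<^sub>R mat 1)
      = det (?K + a *\<^sub>R mat 1) *\<^sub>R (det (block11 M) *\<^sub>R mat 1)" for a
    using adjugate_schur[of "M + a *\<^sub>R P2"] inv(2)
    unfolding A K detM blk sums by (simp_all del: sum.cl_ivl_Suc)
  have An: "block12 (A CARD('n)) = det (block11 M) *\<^sub>R (- ?L)"
    "block22 (A CARD('n)) = det (block11 M) *\<^sub>R mat 1"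
    using leading_coefficients[OF p(1)] leading_coefficients[OF p(2)] by auto
  have detK: "det ?K \<noteq> 0"
    using det_schur[OF inv(2)] inv(1) by (auto simp: invertible_det_nz)
  \<comment> \<open>Both claims follow by multiplying the \<open>adjugate_schur\<close> equations on
    the right by \<open>adjugate ?K\<close> and cancelling \<open>det ?K\<close>, using that
    \<open>det M\<close> is the product of \<open>det (block11 M)\<close> and
    \<open>det ?K\<close>.\<close>
  have *: "Z ** adjugate ?K = X" if "X ** ?K = det M *\<^sub>R Y" "Z = det (block11 M) *\<^sub>R Y"
    for X Y Z :: "real^'n^'r::finite"
  proof -
    have "det ?K *\<^sub>R X = X ** (?K ** adjugate ?K)"
      using detK by (simp add: adjugate_mult_right invertible_det_nz matrix_scalar_ac)
    also have "\<dots> = (det M *\<^sub>R Y) ** adjugate ?K"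
      using that by (simp add: matrix_mul_assoc)
    also have "\<dots> = det ?K *\<^sub>R (Z ** adjugate ?K)"
      using that det_schur[OF inv(2)] by (simp add: mult.commute flip: scalar_matrix_assoc)
    finally show ?thesis using detK by simp
  qed
  show "block12 (A CARD('n)) ** adjugate ?K = block12 (adjugate M)"
    "block22 (A CARD('n)) ** adjugate ?K = block22 (adjugate M)"
    using *[OF adjugate_schur(1)[OF inv(2)] An(1)] *[OF adjugate_schur(2)[OF inv(2)] An(2)] by auto
qed

section \<open>Matrix identities and derivatives of matrix fields\<close>

lemma matrix_diff_ldistrib: "A ** (B - C) = A ** B - A ** C"
  for A :: "real^'n^'m" and B C :: "real^'k^'n"
  by (simp add: matrix_matrix_mult_def vec_eq_iff sum_subtractf right_diff_distrib)

lemma matrix_diff_rdistrib: "(A - B) ** C = A ** C - B ** C"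
  for A B :: "real^'n^'m" and C :: "real^'k^'n"
  by (simp add: matrix_matrix_mult_def vec_eq_iff sum_subtractf left_diff_distrib)

lemma matrix_add_rdistrib: "(A + B) ** C = A ** C + B ** C"
  for A B :: "real^'n^'m" and C :: "real^'k^'n"
  by (simp add: matrix_matrix_mult_def vec_eq_iff sum.distrib distrib_right)

lemma matrix_mult_eq_0_left: "invertible A \<Longrightarrow> A ** B = 0 \<Longrightarrow> B = 0"
  for A :: "real^'n^'n" and B :: "real^'k^'n"
  by (metis matrix_inv_left matrix_mul_assoc matrix_mul_lid times0_right)

lemma matrix_mult_eq_0_right: "invertible A \<Longrightarrow> B ** A = 0 \<Longrightarrow> B = 0"
  for A :: "real^'n^'n" and B :: "real^'n^'k"
  by (metis matrix_inv_right matrix_mul_assoc matrix_mul_rid times0_left)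

lemma vector_matrix_mult_nth: "(x v* A) $ j = (\<Sum>i\<in>UNIV. x $ i * A $ i $ j)"
  by (simp add: vector_matrix_mult_def)

definition pd_matrix :: "'k::finite \<Rightarrow> (real^'k \<Rightarrow> real^'n^'m) \<Rightarrow> real^'k \<Rightarrow> real^'n^'m" where
  "pd_matrix c A p = (\<chi> i j. pd c (\<lambda>q. A q $ i $ j) p)"

lemma pd_matrix_nth [simp]: "pd_matrix c A p $ i $ j = pd c (\<lambda>q. A q $ i $ j) p"
  by (simp add: pd_matrix_def)

lemma pd_matrix_mult:
  fixes A :: "real^'k::finite \<Rightarrow> real^'n::finite^'m::finite" and B :: "real^'k \<Rightarrow> real^'l::finite^'n"
  assumes "\<And>i j. (\<lambda>q. A q $ i $ j) differentiable (at p)" "\<And>i j. (\<lambda>q. B q $ i $ j) differentiable (at p)"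
  shows "pd_matrix c (\<lambda>q. A q ** B q) p = pd_matrix c A p ** B p + A p ** pd_matrix c B p"
proof -
  have "pd c (\<lambda>q. (A q ** B q) $ i $ j) p
      = (\<Sum>k\<in>UNIV. pd c (\<lambda>q. A q $ i $ k) p * B p $ k $ j + A p $ i $ k * pd c (\<lambda>q. B q $ k $ j) p)" for i j
    by (simp add: matrix_matrix_mult_def pd_sum pd_mult assms)
  then show ?thesis
    by (simp add: vec_eq_iff) (simp add: matrix_matrix_mult_def sum.distrib)
qed

lemma pd_trace:
  assumes "\<And>i j. (\<lambda>q. A q $ i $ j) differentiable (at p)"
  shows "pd c (\<lambda>q. trace (A q)) p = trace (pd_matrix c A p)"
  using assms by (simp add: trace_def pd_sum)

lemma pd_det_matrix:
  fixes A :: "real^'k::finite \<Rightarrow> real^'n::finite^'n"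
  assumes "\<And>i j. (\<lambda>q. A q $ i $ j) differentiable (at p)"
  shows "pd c (\<lambda>q. det (A q)) p = trace (adjugate (A p) ** pd_matrix c A p)"
  using assms by (simp add: pd_det pd_matrix_def)

section \<open>The Levi-Civita connection in matrix form\<close>

text \<open>The connection form evaluated on the coordinate vector field of direction
  \<open>c\<close>. With it, the covariant derivative of a type (1,1) tensor is its partial
  derivative plus a commutator.\<close>

definition christoffel_matrix :: "(real^'k::finite \<Rightarrow> real^'k^'k) \<Rightarrow> 'k \<Rightarrow> real^'k \<Rightarrow> real^'k^'k" where
  "christoffel_matrix g c p = (\<chi> a b. christoffel g a b c p)"

lemma symmetric_matrix_nth: "transpose A = A \<Longrightarrow> A $ i $ j = A $ j $ i"
  by (metis transpose_def vec_lambda_beta)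

lemma christoffel_sym:
  assumes "open S" "p \<in> S" "\<And>q. q \<in> S \<Longrightarrow> transpose (g q) = g q"
  shows "christoffel g i j k p = christoffel g i k j p"
proof -
  have "pd l (\<lambda>q. g q $ j $ k) p = pd l (\<lambda>q. g q $ k $ j) p" for l
    by (rule pd_cong_open[OF assms(1,2)]) (rule symmetric_matrix_nth[OF assms(3)])
  then show ?thesis by (simp add: christoffel_def add.commute)
qed

text \<open>Lowering the upper index cancels the inverse metric and leaves the Christoffel symbols
  of the first kind.\<close>

lemma metric_mult_christoffel:
  assumes "invertible (g p)"
  shows "(g p ** christoffel_matrix g c p) $ a $ b
    = (1/2) * (pd b (\<lambda>q. g q $ a $ c) p + pd c (\<lambda>q. g q $ a $ b) p - pd a (\<lambda>q. g q $ b $ c) p)"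
proof -
  define v where "v = (\<chi> l. (1/2) * (pd b (\<lambda>q. g q $ l $ c) p + pd c (\<lambda>q. g q $ l $ b) p - pd l (\<lambda>q. g q $ b $ c) p))"
  have "christoffel g e b c p = (matrix_inv (g p) *v v) $ e" for e
    by (simp add: christoffel_def matrix_vector_mult_def v_def sum_distrib_left mult.left_commute)
  then have "(g p ** christoffel_matrix g c p) $ a $ b = (g p *v (matrix_inv (g p) *v v)) $ a"
    by (simp add: matrix_matrix_mult_def matrix_vector_mult_def christoffel_matrix_def)
  then show ?thesis
    by (simp add: matrix_vector_mul_assoc matrix_inv_right[OF assms] v_def)
qed

text \<open>The vanishing of the covariant derivative of \<open>g\<close>: adding the first-kind
  symbols with \<open>a\<close> and \<open>b\<close> exchanged leaves only the derivative in
  direction \<open>c\<close>.\<close>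

lemma metric_compatible:
  assumes "open S" "p \<in> S" "\<And>q. q \<in> S \<Longrightarrow> transpose (g q) = g q" "invertible (g p)"
  shows "pd_matrix c g p = g p ** christoffel_matrix g c p + transpose (g p ** christoffel_matrix g c p)"
proof -
  have sym: "pd c (\<lambda>q. g q $ b $ a) p = pd c (\<lambda>q. g q $ a $ b) p" for a b
    by (rule pd_cong_open[OF assms(1,2)]) (rule symmetric_matrix_nth[OF assms(3)])
  have "pd c (\<lambda>q. g q $ a $ b) p
    = (g p ** christoffel_matrix g c p) $ a $ b + (g p ** christoffel_matrix g c p) $ b $ a" for a b
    unfolding metric_mult_christoffel[where g = g and p = p, OF assms(4)] using sym[of b a] by (simp add: field_simps)
  then show ?thesis by (simp add: vec_eq_iff transpose_def)
qed

lemma cov_deriv_matrix: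
  "(\<chi> a b. cov_deriv g B a b c p)
    = pd_matrix c B p - transpose (christoffel_matrix g c p) ** B p - B p ** christoffel_matrix g c p"
proof -
  have "(transpose (christoffel_matrix g c p) ** B p) $ a $ b
      = (\<Sum>e\<in>UNIV. christoffel g e a c p * B p $ e $ b)" for a b
    by (simp add: matrix_matrix_mult_def christoffel_matrix_def transpose_def)
  moreover have "(B p ** christoffel_matrix g c p) $ a $ b
      = (\<Sum>e\<in>UNIV. christoffel g e b c p * B p $ a $ e)" for a b
    by (simp add: matrix_matrix_mult_def christoffel_matrix_def mult.commute)
  ultimately show ?thesis by (simp add: vec_eq_iff cov_deriv_def)
qed

text \<open>Because the metric is parallel, lowering an index commutes with covariant
  differentiation; the bracket is the covariant derivative of \<open>J\<close> itself.\<close>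

lemma cov_deriv_lowered:
  assumes S: "open S" "p \<in> S" and g: "pseudo_riemannian S g" and J: "smooth_entries S J"
  shows "(\<chi> a b. cov_deriv g (\<lambda>q. g q ** J q) a b c p)
    = g p ** (pd_matrix c J p + christoffel_matrix g c p ** J p - J p ** christoffel_matrix g c p)"
proof -
  have sym: "transpose (g q) = g q" "invertible (g q)" if "q \<in> S" for q
    using g that by (auto simp: pseudo_riemannian_def smooth_matrix_iff)
  have dg: "(\<lambda>q. g q $ i $ j) differentiable (at p)" for i j
    using g S smooth_on_differentiable smooth_entriesD unfolding pseudo_riemannian_def smooth_matrix_iff by blast
  have dJ: "(\<lambda>q. J q $ i $ j) differentiable (at p)" for i j
    using J S smooth_on_differentiable smooth_entriesD by blast
  have compat: "pd_matrix c g p = g p ** christoffel_matrix g c p + transpose (g p ** christoffel_matrix g c p)"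
    using S sym by (intro metric_compatible) auto
  show ?thesis
    unfolding cov_deriv_matrix pd_matrix_mult[OF dg dJ] compat
    by (simp add: matrix_transpose_mul sym(1)[OF S(2)] matrix_add_ldistrib matrix_diff_ldistrib
        matrix_add_rdistrib matrix_mul_assoc)
qed

section \<open>Special conformal Killing tensors in mixed components\<close>

text \<open>
  The defining equation of a special conformal Killing tensor with the first index raised. Any
  \<open>\<beta>\<close> on its right-hand side is the differential of the trace.
\<close>

lemma scKt_mixed_form:
  fixes g J :: "real^'k::finite \<Rightarrow> real^'k^'k" and \<beta> :: "real^'k"
  assumes S: "open S" "p \<in> S" and g: "pseudo_riemannian S g" and J: "smooth_entries S J"
    and cov: "\<And>a b c. cov_deriv g (\<lambda>q. g q ** J q) a b c p
      = (1/2) * (\<beta> $ a * g p $ b $ c + \<beta> $ b * g p $ a $ c)"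
  shows "pd_matrix c J p = J p ** christoffel_matrix g c p - christoffel_matrix g c p ** J p
      + (\<chi> a b. (1/2) * ((matrix_inv (g p) *v \<beta>) $ a * g p $ b $ c + mat 1 $ a $ c * \<beta> $ b))"
    and "d0 (\<lambda>q. trace (J q)) p = \<beta>"
proof -
  let ?C = "\<lambda>c. christoffel_matrix g c p"
  let ?a = "matrix_inv (g p) *v \<beta>"
  let ?N = "\<lambda>c. \<chi> a b. (1/2) * (?a $ a * g p $ b $ c + mat 1 $ a $ c * \<beta> $ b)"
  have sym: "transpose (g q) = g q" "invertible (g q)" if "q \<in> S" for q
    using g that by (auto simp: pseudo_riemannian_def smooth_matrix_iff)
  have dJ: "(\<lambda>q. J q $ i $ j) differentiable (at p)" for i j
    using J S smooth_on_differentiable smooth_entriesD by blast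
  have ga: "g p *v ?a = \<beta>"
    by (simp add: matrix_vector_mul_assoc matrix_inv_right sym(2) S(2))
  have mixed: "pd_matrix c J p = J p ** ?C c - ?C c ** J p + ?N c" for c
  proof -
    have "g p ** ?N c = (\<chi> a b. (1/2) * (\<beta> $ a * g p $ b $ c + \<beta> $ b * g p $ a $ c))"
    proof -
      have "(g p ** ?N c) $ a $ b = (1/2) * ((g p *v ?a) $ a * g p $ b $ c + \<beta> $ b * (g p ** mat 1) $ a $ c)" for a b
        by (simp only: matrix_matrix_mult_def matrix_vector_mult_def vec_lambda_beta)
          (simp add: sum_distrib_left sum_distrib_right sum.distrib algebra_simps)
      then show ?thesis by (simp add: vec_eq_iff ga)
    qed
    also have "\<dots> = (\<chi> a b. cov_deriv g (\<lambda>q. g q ** J q) a b c p)"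
      by (simp add: cov)
    also have "\<dots> = g p ** (pd_matrix c J p + ?C c ** J p - J p ** ?C c)"
      by (rule cov_deriv_lowered[OF S g J])
    finally have "matrix_inv (g p) ** (g p ** ?N c)
        = matrix_inv (g p) ** (g p ** (pd_matrix c J p + ?C c ** J p - J p ** ?C c))" by simp
    then have "?N c = pd_matrix c J p + ?C c ** J p - J p ** ?C c"
      by (simp only: matrix_mul_assoc matrix_inv_left sym(2)[OF S(2)] matrix_mul_lid)
    then show ?thesis by simp
  qed
  then show "pd_matrix c J p = J p ** ?C c - ?C c ** J p + ?N c" .
  \<comment> \<open>The commutator is traceless, and the two terms of \<open>?N c\<close> contribute
    half of the component \<open>\<beta> $ c\<close> each.\<close>
  have "pd c (\<lambda>q. trace (J q)) p = \<beta> $ c" for c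
  proof -
    have "trace (?N c) = (1/2) * ((\<Sum>a\<in>UNIV. g p $ c $ a * ?a $ a) + (\<Sum>a\<in>UNIV. mat 1 $ a $ c * \<beta> $ a))"
      unfolding trace_def vec_lambda_beta symmetric_matrix_nth[OF sym(1)[OF S(2)], of _ c]
      by (simp add: sum.distrib sum_distrib_left algebra_simps)
    also have "\<dots> = (1/2) * ((g p *v ?a) $ c + \<beta> $ c)"
      by (simp add: matrix_vector_mult_def mat_def if_distrib[of "\<lambda>x. x * _"] cong: if_cong)
    finally have "trace (?N c) = \<beta> $ c" by (simp add: ga)
    then show ?thesis
      unfolding pd_trace[OF dJ] mixed by (simp add: trace_add trace_sub trace_mul_sym[of "J p"])
  qed
  then show "d0 (\<lambda>q. trace (J q)) p = \<beta>" by (simp add: d0_def vec_eq_iff)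
qed

text \<open>A covector may be exhibited separately at each point, without reference to the trace:
  \<open>scKt_mixed_form\<close> identifies it as the differential of the trace.\<close>

lemma scKtI:
  assumes "open S" "pseudo_riemannian S g" "smooth_entries S J"
    and "\<And>p. p \<in> S \<Longrightarrow> transpose (g p ** J p) = g p ** J p"
    and "\<And>p. p \<in> S \<Longrightarrow> \<exists>\<beta>. \<forall>a b c. cov_deriv g (\<lambda>q. g q ** J q) a b c p
      = (1/2) * (\<beta> $ a * g p $ b $ c + \<beta> $ b * g p $ a $ c)"
  shows "scKt S g J"
proof -
  have "cov_deriv g (\<lambda>q. g q ** J q) a b c p = (1/2) *
      (d0 (\<lambda>q. trace (J q)) p $ a * g p $ b $ c + d0 (\<lambda>q. trace (J q)) p $ b * g p $ a $ c)"
    if p: "p \<in> S" for p a b c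
  proof -
    obtain \<beta> where \<beta>: "\<And>a b c. cov_deriv g (\<lambda>q. g q ** J q) a b c p
        = (1/2) * (\<beta> $ a * g p $ b $ c + \<beta> $ b * g p $ a $ c)"
      using assms(5)[OF p] by blast
    show ?thesis
      unfolding scKt_mixed_form(2)[OF assms(1) p assms(2,3) \<beta>] by (rule \<beta>)
  qed
  then show ?thesis
    using assms(2-4) unfolding scKt_def smooth_matrix_iff Let_def by blast
qed

lemma scKtD:
  assumes "open S" "scKt S g J" "p \<in> S"
  shows "pd_matrix c J p = J p ** christoffel_matrix g c p - christoffel_matrix g c p ** J p
      + (\<chi> a b. (1/2) * ((matrix_inv (g p) *v d0 (\<lambda>q. trace (J q)) p) $ a * g p $ b $ c
          + mat 1 $ a $ c * d0 (\<lambda>q. trace (J q)) p $ b))"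
  using assms by (intro scKt_mixed_form(1)) (auto simp: scKt_def smooth_matrix_iff Let_def)

text \<open>This is the vanishing of the Nijenhuis torsion in components. After substituting
  \<open>scKtD\<close>, the terms not symmetric in \<open>k\<close> and \<open>l\<close> agree on
  the two sides, while symmetry of the connection, of \<open>g\<close> and of the lowered
  \<open>J\<close> removes the others.\<close>

lemma scKt_nijenhuis_torsion_free:
  assumes "open S" "scKt S g J" "p \<in> S"
  shows "(\<Sum>s\<in>UNIV. J p $ s $ k * pd s (\<lambda>q. J q $ t $ l) p) - (\<Sum>s\<in>UNIV. J p $ s $ l * pd s (\<lambda>q. J q $ t $ k) p)
    = (\<Sum>i\<in>UNIV. J p $ t $ i * pd k (\<lambda>q. J q $ i $ l) p) - (\<Sum>i\<in>UNIV. J p $ t $ i * pd l (\<lambda>q. J q $ i $ k) p)"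
proof -
  let ?\<alpha> = "d0 (\<lambda>q. trace (J q)) p"
  let ?a = "matrix_inv (g p) *v ?\<alpha>"
  let ?J = "\<lambda>i j. J p $ i $ j"
  let ?G = "\<lambda>a b c. christoffel g a b c p"
  have g: "transpose (g q) = g q" if "q \<in> S" for q
    using assms that by (auto simp: scKt_def pseudo_riemannian_def smooth_matrix_iff)
  have G: "?G a b c = ?G a c b" for a b c
    by (rule christoffel_sym[OF assms(1,3) g])
  have gJ: "(g p ** J p) $ i $ j = (g p ** J p) $ j $ i" for i j
    using assms by (intro symmetric_matrix_nth) (auto simp: scKt_def smooth_matrix_iff)
  have dJ: "pd s (\<lambda>q. J q $ i $ j) p = (\<Sum>e\<in>UNIV. ?J i e * ?G e j s) - (\<Sum>e\<in>UNIV. ?G i e s * ?J e j)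
      + (1/2) * (?a $ i * g p $ j $ s + mat 1 $ i $ s * ?\<alpha> $ j)" for s i j
    using arg_cong[OF scKtD[OF assms, of s], of "\<lambda>M. M $ i $ j"]
    by (simp add: matrix_matrix_mult_def christoffel_matrix_def)
  \<comment> \<open>The connection terms sorted by where the two factors \<open>J\<close> attach:
    \<open>X\<close> has one on the upper and one on a lower index, \<open>Y\<close> both on lower
    indices, \<open>Z\<close> both on the upper index. \<open>Y\<close> and \<open>Z\<close> are
    symmetric; \<open>X\<close> occurs equally on both sides.\<close>
  define X where "X k l = (\<Sum>e\<in>UNIV. ?J t e * (\<Sum>s\<in>UNIV. ?J s k * ?G e l s))" for k l
  define Y where "Y k l = (\<Sum>s\<in>UNIV. \<Sum>e\<in>UNIV. ?J s k * ?J e l * ?G t e s)" for k l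
  define Z where "Z k l = (\<Sum>i\<in>UNIV. \<Sum>e\<in>UNIV. ?J t i * ?J i e * ?G e l k)" for k l
  have Y: "Y k l = Y l k" for k l
    unfolding Y_def by (subst sum.swap) (simp add: G[of t] mult.commute mult.left_commute)
  have Z: "Z k l = Z l k" for k l
    unfolding Z_def by (simp only: G[of _ l k])
  have lhs: "(\<Sum>s\<in>UNIV. ?J s k * pd s (\<lambda>q. J q $ t $ l) p)
      = X k l - Y k l + (1/2) * (?a $ t * (g p ** J p) $ l $ k + ?\<alpha> $ l * ?J t k)" for k l
  proof -
    have "(\<Sum>s\<in>UNIV. ?J s k * (\<Sum>e\<in>UNIV. ?J t e * ?G e l s)) = X k l"
      unfolding X_def sum_distrib_left by (subst sum.swap) (simp add: mult.left_commute)
    moreover have "(\<Sum>s\<in>UNIV. ?J s k * (\<Sum>e\<in>UNIV. ?G t e s * ?J e l)) = Y k l"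
      unfolding Y_def sum_distrib_left by (simp add: mult_ac)
    moreover have "(\<Sum>s\<in>UNIV. ?J s k * (g p $ l $ s)) = (g p ** J p) $ l $ k"
      by (simp add: matrix_matrix_mult_def mult.commute)
    moreover have "(\<Sum>s\<in>UNIV. ?J s k * mat 1 $ t $ s) = ?J t k"
      by (simp add: mat_def if_distrib[of "\<lambda>x. _ * x"] cong: if_cong)
    moreover have "(\<Sum>s\<in>UNIV. ?J s k * pd s (\<lambda>q. J q $ t $ l) p)
      = (\<Sum>s\<in>UNIV. ?J s k * (\<Sum>e\<in>UNIV. ?J t e * ?G e l s)) - (\<Sum>s\<in>UNIV. ?J s k * (\<Sum>e\<in>UNIV. ?G t e s * ?J e l))
        + (1/2) * (?a $ t * (\<Sum>s\<in>UNIV. ?J s k * (g p $ l $ s)) + ?\<alpha> $ l * (\<Sum>s\<in>UNIV. ?J s k * mat 1 $ t $ s))"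
    proof -
      have "?J s k * pd s (\<lambda>q. J q $ t $ l) p
        = ?J s k * (\<Sum>e\<in>UNIV. ?J t e * ?G e l s) - ?J s k * (\<Sum>e\<in>UNIV. ?G t e s * ?J e l)
        + ((1/2) * ?a $ t * (?J s k * g p $ l $ s) + (1/2) * ?\<alpha> $ l * (?J s k * mat 1 $ t $ s))" for s
        unfolding dJ by (simp add: algebra_simps)
      then show ?thesis
        by (simp only: sum.distrib sum_subtractf sum_distrib_left[symmetric]) (simp add: algebra_simps)
    qed
    ultimately show ?thesis by simp
  qed
  have rhs: "(\<Sum>i\<in>UNIV. ?J t i * pd k (\<lambda>q. J q $ i $ l) p)
      = Z k l - X l k + (1/2) * ((\<Sum>i\<in>UNIV. ?J t i * ?a $ i) * g p $ l $ k + ?\<alpha> $ l * ?J t k)" for k l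
  proof -
    have "(\<Sum>i\<in>UNIV. ?J t i * (\<Sum>e\<in>UNIV. ?J i e * ?G e l k)) = Z k l"
      unfolding Z_def sum_distrib_left by (simp add: mult.assoc)
    moreover have "(\<Sum>i\<in>UNIV. ?J t i * (\<Sum>e\<in>UNIV. ?G i e k * ?J e l)) = X l k"
      unfolding X_def by (simp add: G[of _ _ k] mult.commute)
    moreover have "(\<Sum>i\<in>UNIV. ?J t i * mat 1 $ i $ k) = ?J t k"
      by (simp add: mat_def if_distrib[of "\<lambda>x. _ * x"] cong: if_cong)
    moreover have "(\<Sum>i\<in>UNIV. ?J t i * pd k (\<lambda>q. J q $ i $ l) p)
      = (\<Sum>i\<in>UNIV. ?J t i * (\<Sum>e\<in>UNIV. ?J i e * ?G e l k)) - (\<Sum>i\<in>UNIV. ?J t i * (\<Sum>e\<in>UNIV. ?G i e k * ?J e l))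
        + (1/2) * ((\<Sum>i\<in>UNIV. ?J t i * ?a $ i) * g p $ l $ k + ?\<alpha> $ l * (\<Sum>i\<in>UNIV. ?J t i * mat 1 $ i $ k))"
    proof -
      have "?J t i * pd k (\<lambda>q. J q $ i $ l) p
        = ?J t i * (\<Sum>e\<in>UNIV. ?J i e * ?G e l k) - ?J t i * (\<Sum>e\<in>UNIV. ?G i e k * ?J e l)
        + ((1/2) * g p $ l $ k * (?J t i * ?a $ i) + (1/2) * ?\<alpha> $ l * (?J t i * mat 1 $ i $ k))" for i
        unfolding dJ by (simp add: algebra_simps)
      then show ?thesis
        by (simp only: sum.distrib sum_subtractf sum_distrib_left[symmetric]) (simp add: algebra_simps)
    qed
    ultimately show ?thesis by simp
  qed
  show ?thesis
    unfolding lhs rhs Y[of k l] Z[of k l] gJ[of k l] symmetric_matrix_nth[OF g[OF assms(3)], of k l]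
    by (simp add: algebra_simps)
qed

text \<open>By Jacobi's formula the derivative is the trace of cof J times the derivative of J. The
  connection terms cancel because J and cof J commute, and the two remaining terms contribute equal
  halves because cof J is symmetric with respect to g.\<close>

lemma scKt_d0_det:
  assumes "open S" "scKt S g J" "p \<in> S" "invertible (J p)"
  shows "d0 (\<lambda>q. det (J q)) p = d0 (\<lambda>q. trace (J q)) p v* adjugate (J p)"
proof -
  let ?\<alpha> = "d0 (\<lambda>q. trace (J q)) p"
  let ?a = "matrix_inv (g p) *v ?\<alpha>"
  let ?A = "adjugate (J p)"
  let ?D = "det (J p)"
  have g: "transpose (g p) = g p" "invertible (g p)" and sym: "transpose (g p ** J p) = g p ** J p"
    using assms by (auto simp: scKt_def pseudo_riemannian_def smooth_matrix_iff)
  have dJ: "(\<lambda>q. J q $ i $ j) differentiable (at p)" for i j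
    using assms smooth_on_differentiable smooth_entriesD unfolding scKt_def smooth_matrix_iff by blast
  have D: "?D \<noteq> 0" using assms(4) invertible_det_nz by blast
  have JA: "J p ** ?A = ?D *\<^sub>R mat 1" "?A ** J p = ?D *\<^sub>R mat 1"
    by (simp_all add: adjugate_mult_left adjugate_mult_right assms(4))
  \<comment> \<open>The symmetry of cof J with respect to g comes from inserting J (cof J) = det J
    on one side, moving J across g, and using it again on the other side.\<close>
  have "?D *\<^sub>R (g p ** ?A) = transpose (J p ** ?A) ** g p ** ?A"
    by (simp add: JA transpose_mat matrix_scalar_ac transpose_scalar flip: scalar_matrix_assoc)
  also have "\<dots> = transpose ?A ** (transpose (J p) ** transpose (g p)) ** ?A"
    by (simp add: matrix_transpose_mul matrix_mul_assoc g)
  also have "\<dots> = transpose ?A ** g p ** (J p ** ?A)"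
    by (simp only: matrix_transpose_mul[symmetric] sym matrix_mul_assoc)
  also have "\<dots> = ?D *\<^sub>R (transpose ?A ** g p)"
    by (simp add: JA matrix_scalar_ac)
  finally have gA: "g p ** ?A = transpose ?A ** g p" using D by simp
  have "pd c (\<lambda>q. det (J q)) p = (?\<alpha> v* ?A) $ c" for c
  proof -
    let ?C = "christoffel_matrix g c p"
    let ?N = "\<chi> a b. (1/2) * (?a $ a * g p $ b $ c + mat 1 $ a $ c * ?\<alpha> $ b)"
    have "trace (?A ** (J p ** ?C)) = ?D * trace ?C"
      by (simp add: matrix_mul_assoc JA flip: scalar_matrix_assoc) (simp add: trace_def sum_distrib_left)
    moreover have "trace (?A ** (?C ** J p)) = ?D * trace ?C"
      by (subst trace_mul_sym) (simp add: JA matrix_scalar_ac flip: matrix_mul_assoc, simp add: trace_def sum_distrib_left)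
    ultimately have "trace (?A ** pd_matrix c J p) = trace (?A ** ?N)"
      unfolding scKtD[OF assms(1-3)] by (simp add: matrix_add_ldistrib matrix_diff_ldistrib trace_add trace_sub)
    also have "\<dots> = (\<Sum>b\<in>UNIV. \<Sum>a\<in>UNIV. ?A $ b $ a * ?N $ a $ b)"
      by (simp add: trace_def matrix_matrix_mult_def)
    also have "\<dots> = (1/2) * ((\<Sum>b\<in>UNIV. \<Sum>a\<in>UNIV. g p $ c $ b * ?A $ b $ a * ?a $ a)
        + (\<Sum>b\<in>UNIV. ?\<alpha> $ b * (\<Sum>a\<in>UNIV. ?A $ b $ a * mat 1 $ a $ c)))"
      unfolding vec_lambda_beta symmetric_matrix_nth[OF g(1), of _ c]
      by (simp add: sum.distrib sum_distrib_left algebra_simps)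
    also have "(\<Sum>b\<in>UNIV. \<Sum>a\<in>UNIV. g p $ c $ b * ?A $ b $ a * ?a $ a) = ((g p ** ?A) *v ?a) $ c"
      by (subst sum.swap) (simp add: matrix_matrix_mult_def matrix_vector_mult_def sum_distrib_right)
    also have "(g p ** ?A) *v ?a = ?\<alpha> v* ?A"
      unfolding gA by (simp add: matrix_vector_mul_assoc matrix_inv_right[OF g(2)] flip: matrix_mul_assoc)
    also have "(\<Sum>b\<in>UNIV. ?\<alpha> $ b * (\<Sum>a\<in>UNIV. ?A $ b $ a * mat 1 $ a $ c)) = (?\<alpha> v* ?A) $ c"
      by (simp add: vector_matrix_mult_def mat_def if_distrib[of "\<lambda>x. _ * x"] cong: if_cong)
    finally show ?thesis by (simp add: pd_det_matrix dJ)
  qed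
  then show ?thesis by (simp add: d0_def vec_eq_iff)
qed

section \<open>Closedness of the 1-form (cof J) mu\<close>

lemma DJ1_nth:
  "DJ1 J \<mu> p $ k $ l = (\<Sum>s\<in>UNIV. J p $ s $ k * pd s (\<lambda>q. \<mu> q $ l) p) - (\<Sum>s\<in>UNIV. J p $ s $ l * pd s (\<lambda>q. \<mu> q $ k) p)
    - (\<Sum>i\<in>UNIV. \<mu> p $ i * (pd k (\<lambda>q. J q $ i $ l) p - pd l (\<lambda>q. J q $ i $ k) p))
    + (d0 (\<lambda>q. trace (J q)) p $ k * \<mu> p $ l - d0 (\<lambda>q. trace (J q)) p $ l * \<mu> p $ k)"
proof -
  have a: "(axis i 1 v* J q) $ l = J q $ i $ l" for i l q
    by (simp add: vector_matrix_mult_def axis_def if_distrib[of "\<lambda>x. x * _"] cong: if_cong)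
  have w: "wedge \<beta> (axis i 1) $ k $ l = (if i = l then \<beta> $ k else 0) - (if i = k then \<beta> $ l else 0)"
    for \<beta> :: "real^'a" and i k l
    by (simp add: wedge_def axis_def)
  show ?thesis
    by (simp add: DJ1_def dJ1_def sum_subtractf w a d1_def dJ0_def d0_def)
      (simp add: wedge_def vector_matrix_mult_def d0_def mult.commute)
qed

text \<open>
  With \<open>\<rho> = (cof J) \<mu>\<close>, differentiating \<open>\<rho> J = (det J) \<mu>\<close> expresses \<open>J\<close> applied to both
  arguments of \<open>d \<rho>\<close> as \<open>(det J) D\<^sub>J \<mu>\<close> minus \<open>\<rho>\<close> applied to the Nijenhuis torsion of \<open>J\<close>.
\<close>

lemma d1_cofactor_form_eq_0:
  assumes S: "open S" "scKt S g J" "p \<in> S" and inv: "\<And>q. q \<in> S \<Longrightarrow> invertible (J q)"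
    and \<mu>: "smooth_form S \<mu>" "DJ1 J \<mu> p = 0"
  shows "d1 (\<lambda>q. \<mu> q v* adjugate (J q)) p = 0"
proof -
  let ?\<alpha> = "d0 (\<lambda>q. trace (J q)) p"
  let ?\<rho> = "\<lambda>q. \<mu> q v* adjugate (J q)"
  let ?J = "\<lambda>i j. J p $ i $ j"
  let ?D = "det (J p)"
  have J: "smooth_entries S J" using S by (simp add: scKt_def smooth_matrix_iff)
  have dJ: "(\<lambda>q. J q $ i $ j) differentiable (at p)" for i j
    using J S smooth_on_differentiable smooth_entriesD by blast
  have d\<mu>: "(\<lambda>q. \<mu> q $ i) differentiable (at p)" for i
    using \<mu>(1) S smooth_on_differentiable unfolding smooth_form_def by blast
  have d\<rho>: "(\<lambda>q. ?\<rho> q $ i) differentiable (at p)" for i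
    using smooth_form_vector_matrix_mult[OF S(1) \<mu>(1) smooth_entries_adjugate[OF S(1) J]] S(3)
      smooth_on_differentiable unfolding smooth_form_def by blast
  have dD: "(\<lambda>q. det (J q)) differentiable (at p)"
    using smooth_on_det[OF S(1) J] S(3) smooth_on_differentiable by blast
  have D: "pd s (\<lambda>q. det (J q)) p = (?\<alpha> v* adjugate (J p)) $ s" for s
    using scKt_d0_det[OF S inv[OF S(3)]] by (simp add: d0_def vec_eq_iff)
  have \<rho>J: "?\<rho> q v* J q = det (J q) *\<^sub>R \<mu> q" for q
    by (simp add: vector_matrix_mul_assoc adjugate_mult_left vector_scaleR_matrix_ac)
  have \<rho>J': "(\<Sum>t\<in>UNIV. ?\<rho> q $ t * J q $ t $ l) = det (J q) * \<mu> q $ l" for q l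
    using arg_cong[OF \<rho>J, of "\<lambda>v. v $ l" q] by (simp only: vector_matrix_mult_nth[of "?\<rho> q"] vector_scaleR_component real_scaleR_def)
  have eq1: "(\<Sum>t\<in>UNIV. pd s (\<lambda>q. ?\<rho> q $ t) p * ?J t l) + (\<Sum>t\<in>UNIV. ?\<rho> p $ t * pd s (\<lambda>q. J q $ t $ l) p)
      = (?\<alpha> v* adjugate (J p)) $ s * \<mu> p $ l + ?D * pd s (\<lambda>q. \<mu> q $ l) p" for s l
  proof -
    have "pd s (\<lambda>q. \<Sum>t\<in>UNIV. ?\<rho> q $ t * J q $ t $ l) p = pd s (\<lambda>q. det (J q) * \<mu> q $ l) p"
      by (simp only: \<rho>J')
    then show ?thesis
      by (simp add: pd_sum pd_mult d\<rho> dJ dD d\<mu> sum.distrib D)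
  qed
  \<comment> \<open>Applying J to d(det J) = (cof J) d(tr J) produces exactly the trace term of the
    operator \<open>DJ1\<close>, up to the factor det J.\<close>
  have \<alpha>J: "(\<Sum>s\<in>UNIV. ?J s k * (?\<alpha> v* adjugate (J p)) $ s) = ?D * ?\<alpha> $ k" for k
  proof -
    have "(?\<alpha> v* adjugate (J p)) v* J p = ?D *\<^sub>R ?\<alpha>"
      by (simp add: vector_matrix_mul_assoc adjugate_mult_left vector_scaleR_matrix_ac)
    from arg_cong[OF this, of "\<lambda>v. v $ k"] show ?thesis
      by (simp only: vector_matrix_mult_nth[of "?\<alpha> v* adjugate (J p)"] vector_scaleR_component real_scaleR_def mult.commute[of "?J _ k"])
  qed
  \<comment> \<open>\<open>R\<close> is the Jacobian of \<open>?\<rho>\<close>, so the antisymmetric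
    part of \<open>P\<close> carries d rho with J applied to both arguments; J being invertible, it
    suffices that this part vanishes.\<close>
  define R where "R = (\<chi> s t. pd s (\<lambda>q. ?\<rho> q $ t) p)"
  define P where "P = transpose (J p) ** (R ** J p)"
  have P: "P $ k $ l = - (\<Sum>t\<in>UNIV. ?\<rho> p $ t * (\<Sum>s\<in>UNIV. ?J s k * pd s (\<lambda>q. J q $ t $ l) p))
      + ?D * ?\<alpha> $ k * \<mu> p $ l + ?D * (\<Sum>s\<in>UNIV. ?J s k * pd s (\<lambda>q. \<mu> q $ l) p)" for k l
  proof -
    have "P $ k $ l = (\<Sum>s\<in>UNIV. ?J s k * (\<Sum>t\<in>UNIV. pd s (\<lambda>q. ?\<rho> q $ t) p * ?J t l))"
      by (simp add: P_def R_def matrix_matrix_mult_def transpose_def)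
    also have "\<dots> = (\<Sum>s\<in>UNIV. ?J s k * (?\<alpha> v* adjugate (J p)) $ s * \<mu> p $ l
        + ?D * (?J s k * pd s (\<lambda>q. \<mu> q $ l) p) - ?J s k * (\<Sum>t\<in>UNIV. ?\<rho> p $ t * pd s (\<lambda>q. J q $ t $ l) p))"
    proof (intro sum.cong refl)
      fix s
      show "?J s k * (\<Sum>t\<in>UNIV. pd s (\<lambda>q. ?\<rho> q $ t) p * ?J t l) = ?J s k * (?\<alpha> v* adjugate (J p)) $ s * \<mu> p $ l
        + ?D * (?J s k * pd s (\<lambda>q. \<mu> q $ l) p) - ?J s k * (\<Sum>t\<in>UNIV. ?\<rho> p $ t * pd s (\<lambda>q. J q $ t $ l) p)"
        using arg_cong[OF eq1[of s l], of "\<lambda>x. ?J s k * x"] by (simp only: distrib_left) (simp add: mult_ac)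
    qed
    also have "\<dots> = (\<Sum>s\<in>UNIV. ?J s k * (?\<alpha> v* adjugate (J p)) $ s) * \<mu> p $ l
        + ?D * (\<Sum>s\<in>UNIV. ?J s k * pd s (\<lambda>q. \<mu> q $ l) p)
        - (\<Sum>s\<in>UNIV. ?J s k * (\<Sum>t\<in>UNIV. ?\<rho> p $ t * pd s (\<lambda>q. J q $ t $ l) p))"
      by (simp only: sum.distrib sum_subtractf sum_distrib_left[symmetric] sum_distrib_right[symmetric])
    also have "(\<Sum>s\<in>UNIV. ?J s k * (\<Sum>t\<in>UNIV. ?\<rho> p $ t * pd s (\<lambda>q. J q $ t $ l) p))
        = (\<Sum>t\<in>UNIV. ?\<rho> p $ t * (\<Sum>s\<in>UNIV. ?J s k * pd s (\<lambda>q. J q $ t $ l) p))"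
      unfolding sum_distrib_left by (subst sum.swap) (simp only: mult.left_commute)
    finally show ?thesis by (simp only: \<alpha>J)
  qed
  have "P $ k $ l - P $ l $ k = 0" for k l
  proof -
    let ?L = "\<lambda>t k l. \<Sum>s\<in>UNIV. ?J s k * pd s (\<lambda>q. J q $ t $ l) p"
    let ?M = "\<lambda>k l. \<Sum>s\<in>UNIV. ?J s k * pd s (\<lambda>q. \<mu> q $ l) p"
    let ?T = "\<lambda>i. pd k (\<lambda>q. J q $ i $ l) p - pd l (\<lambda>q. J q $ i $ k) p"
    have N: "(\<Sum>i\<in>UNIV. ?J t i * ?T i) = ?L t k l - ?L t l k" for t
      using scKt_nijenhuis_torsion_free[OF S, of k t l] by (simp only: right_diff_distrib sum_subtractf)
    have "?M k l - ?M l k + (?\<alpha> $ k * \<mu> p $ l - ?\<alpha> $ l * \<mu> p $ k) = (\<Sum>i\<in>UNIV. \<mu> p $ i * ?T i)"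
      using DJ1_nth[of J \<mu> p k l] \<mu>(2) by simp
    then have "?D * (?M k l - ?M l k + (?\<alpha> $ k * \<mu> p $ l - ?\<alpha> $ l * \<mu> p $ k)) = (\<Sum>i\<in>UNIV. (?D * \<mu> p $ i) * ?T i)"
      by (simp only: sum_distrib_left mult.assoc)
    \<comment> \<open>Writing det J times mu as rho J puts the derivatives of J into the contraction
      with J that the torsion identity \<open>N\<close> evaluates.\<close>
    also have "\<dots> = (\<Sum>i\<in>UNIV. (\<Sum>t\<in>UNIV. ?\<rho> p $ t * ?J t i * ?T i))"
      by (simp only: \<rho>J'[symmetric] sum_distrib_right)
    also have "\<dots> = (\<Sum>t\<in>UNIV. ?\<rho> p $ t * (\<Sum>i\<in>UNIV. ?J t i * ?T i))"
      by (subst sum.swap) (simp only: sum_distrib_left mult.assoc)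
    also have "\<dots> = (\<Sum>t\<in>UNIV. ?\<rho> p $ t * (?L t k l - ?L t l k))"
      by (simp only: N)
    also have "\<dots> = (\<Sum>t\<in>UNIV. ?\<rho> p $ t * ?L t k l) - (\<Sum>t\<in>UNIV. ?\<rho> p $ t * ?L t l k)"
      by (simp only: right_diff_distrib sum_subtractf)
    finally show ?thesis
      unfolding P by (simp only: distrib_left right_diff_distrib mult.assoc)
  qed
  then have "P - transpose P = 0" by (simp add: vec_eq_iff transpose_def)
  moreover have "P - transpose P = transpose (J p) ** (R - transpose R) ** J p"
    by (simp add: P_def matrix_transpose_mul matrix_diff_ldistrib matrix_diff_rdistrib matrix_mul_assoc)
  ultimately have "transpose (J p) ** ((R - transpose R) ** J p) = 0"
    by (simp add: matrix_mul_assoc)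
  then have "(R - transpose R) ** J p = 0"
    using matrix_mult_eq_0_left inv[OF S(3)] det_transpose[of "J p"] invertible_det_nz by metis
  then have "R - transpose R = 0"
    by (rule matrix_mult_eq_0_right[OF inv[OF S(3)]])
  then show ?thesis
    by (simp add: vec_eq_iff R_def d1_def transpose_def)
qed

section \<open>Restriction to slices of constant y\<close>

text \<open>The inclusion of a slice is affine, and \<open>yx 0\<close> is its linear part.\<close>

lemma has_derivative_yx:
  fixes y :: "real^'m::finite" and x :: "real^'n::finite"
  shows "(yx y has_derivative yx 0) (at x)"
proof -
  have "linear (yx 0 :: real^'n \<Rightarrow> real^('m + 'n))"
    by (rule linearI) (simp_all add: vec_eq_iff all_sum yx_def)
  from has_derivative_add[OF has_derivative_const[of "yx y 0"] linear_imp_has_derivative[OF this]]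
  have "((\<lambda>x. yx y 0 + yx 0 x) has_derivative yx 0) (at x)" by simp
  moreover have eq: "yx y = (\<lambda>x. yx y 0 + yx 0 x)"
    by (simp add: fun_eq_iff vec_eq_iff all_sum yx_def)
  ultimately show ?thesis by (subst eq)
qed

lemma open_x_slice:
  assumes "open S"
  shows "open (x_slice S y)"
proof -
  have "continuous_on UNIV (yx y)"
    by (intro continuous_at_imp_continuous_on ballI has_derivative_continuous[OF has_derivative_yx])
  from open_vimage[OF assms this] show ?thesis by (simp add: x_slice_def vimage_def)
qed

lemma slice_derivative:
  fixes y :: "real^'m::finite" and x :: "real^'n::finite"
  assumes "f differentiable (at (yx y x))"
  shows "(\<lambda>x. f (yx y x)) differentiable (at x)"
    and "pd a (\<lambda>x. f (yx y x)) x = pd (Inr a) f (yx y x)"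
proof -
  have D: "((\<lambda>x. f (yx y x)) has_derivative (\<lambda>v. frechet_derivative f (at (yx y x)) (yx 0 v))) (at x)"
    using has_derivative_compose[OF has_derivative_yx] assms frechet_derivative_works by blast
  then show "(\<lambda>x. f (yx y x)) differentiable (at x)" by (rule differentiableI)
  have "yx (0 :: real^'m) (axis a 1) = axis (Inr a) 1"
    by (simp add: vec_eq_iff all_sum yx_def axis_def)
  then show "pd a (\<lambda>x. f (yx y x)) x = pd (Inr a) f (yx y x)"
    using frechet_derivative_at[OF D, symmetric] by (simp add: pd_def)
qed

lemma Ck_on_slice:
  assumes "open S" "Ck_on k S f"
  shows "Ck_on k (x_slice S y) (\<lambda>x. f (yx y x))"
  using assms(2)
proof (induction k arbitrary: f)
  case 0
  have "continuous_on (x_slice S y) (yx y)"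
    by (intro continuous_at_imp_continuous_on ballI has_derivative_continuous[OF has_derivative_yx])
  then show ?case
    using 0 continuous_on_compose2[of S f "x_slice S y" "yx y"] by (auto simp: x_slice_def)
next
  case (Suc k)
  have "Ck_on k (x_slice S y) (pd a (\<lambda>x. f (yx y x)))" for a
  proof (subst Ck_on_cong[OF open_x_slice[OF assms(1)]])
    show "pd a (\<lambda>x. f (yx y x)) x = pd (Inr a) f (yx y x)" if "x \<in> x_slice S y" for x
      using that Suc.prems by (intro slice_derivative) (auto simp: x_slice_def)
    show "Ck_on k (x_slice S y) (\<lambda>x. pd (Inr a) f (yx y x))"
      using Suc by simp
  qed
  then show ?case using Suc.prems by (auto simp: x_slice_def intro!: slice_derivative)
qed

lemma smooth_on_slice: "open S \<Longrightarrow> smooth_on S f \<Longrightarrow> smooth_on (x_slice S y) (\<lambda>x. f (yx y x))"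
  by (simp add: smooth_on_def Ck_on_slice)

lemma smooth_entries_slice:
  "open S \<Longrightarrow> smooth_entries S A \<Longrightarrow> smooth_entries (x_slice S y) (\<lambda>x. A (yx y x))"
  using smooth_on_slice[of S "\<lambda>p. A p $ i $ j" y for i j] by (simp add: smooth_entries_def)

lemma smooth_entries_block:
  assumes "smooth_entries S A"
  shows "smooth_entries S (\<lambda>p. block11 (A p))" "smooth_entries S (\<lambda>p. block12 (A p))"
    "smooth_entries S (\<lambda>p. block21 (A p))" "smooth_entries S (\<lambda>p. block22 (A p))"
  using assms by (simp_all add: smooth_entries_def block11_def block12_def block21_def block22_def)

lemma smooth_entries_cong:
  assumes "open S" "\<And>p. p \<in> S \<Longrightarrow> A p = B p"
  shows "smooth_entries S A \<longleftrightarrow> smooth_entries S B"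
proof -
  have "smooth_on S (\<lambda>p. A p $ i $ j) \<longleftrightarrow> smooth_on S (\<lambda>p. B p $ i $ j)" for i j
    by (rule smooth_on_cong[OF assms(1)]) (simp add: assms(2))
  then show ?thesis by (simp add: smooth_entries_def)
qed

lemma smooth_entries_scaleR:
  assumes "open S" "smooth_on S k" "smooth_entries S A"
  shows "smooth_entries S (\<lambda>p. k p *\<^sub>R A p)"
  using assms by (simp add: smooth_entries_def smooth_on_mult)

lemma smooth_entries_diff:
  assumes "open S" "smooth_entries S A" "smooth_entries S B"
  shows "smooth_entries S (\<lambda>p. A p - B p)"
  using assms by (simp add: smooth_entries_def smooth_on_diff)

lemma smooth_entries_matrix_inv:
  fixes A :: "real^'k::finite \<Rightarrow> real^'n::finite^'n"
  assumes "open S" "smooth_entries S A" "\<And>p. p \<in> S \<Longrightarrow> invertible (A p)"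
  shows "smooth_entries S (\<lambda>p. matrix_inv (A p))"
proof (subst smooth_entries_cong[OF assms(1)])
  show "matrix_inv (A p) = inverse (det (A p)) *\<^sub>R adjugate (A p)" if "p \<in> S" for p
    using that assms(3) by (intro matrix_inv_eq_adjugate)
  show "smooth_entries S (\<lambda>p. inverse (det (A p)) *\<^sub>R adjugate (A p))"
    using assms invertible_det_nz
    by (intro smooth_entries_scaleR smooth_on_inverse smooth_on_det smooth_entries_adjugate) blast+
qed

lemma smooth_entries_differentiable:
  "smooth_entries S A \<Longrightarrow> p \<in> S \<Longrightarrow> (\<lambda>q. A q $ i $ j) differentiable (at p)"
  using smooth_entriesD smooth_on_differentiable by blast

lemma pd_matrix_diff:
  assumes "\<And>i j. (\<lambda>q. A q $ i $ j) differentiable (at p)" "\<And>i j. (\<lambda>q. B q $ i $ j) differentiable (at p)"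
  shows "pd_matrix c (\<lambda>q. A q - B q) p = pd_matrix c A p - pd_matrix c B p"
  by (simp add: vec_eq_iff pd_diff assms)

text \<open>Differentiating (inverse of A) A = 1 leaves the derivative of the inverse times A equal
  to zero.\<close>

lemma pd_matrix_matrix_inv_eq_0:
  fixes A :: "real^'k::finite \<Rightarrow> real^'n::finite^'n"
  assumes "open S" "smooth_entries S A" "\<And>p. p \<in> S \<Longrightarrow> invertible (A p)" "p \<in> S" "pd_matrix c A p = 0"
  shows "pd_matrix c (\<lambda>q. matrix_inv (A q)) p = 0"
proof -
  have "pd c (\<lambda>q. (matrix_inv (A q) ** A q) $ i $ j) p = pd c (\<lambda>q. mat 1 $ i $ j) p" for i j
    by (rule pd_cong_open[OF assms(1,4)]) (simp add: matrix_inv_left assms(3))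
  then have "pd_matrix c (\<lambda>q. matrix_inv (A q) ** A q) p = 0" by (simp add: vec_eq_iff)
  then have "pd_matrix c (\<lambda>q. matrix_inv (A q)) p ** A p = 0"
    using smooth_entries_differentiable[OF smooth_entries_matrix_inv[OF assms(1-3)] assms(4)]
      smooth_entries_differentiable[OF assms(2,4)] assms(5)
    by (simp add: pd_matrix_mult)
  then show ?thesis by (rule matrix_mult_eq_0_right[OF assms(3)[OF assms(4)]])
qed

lemma pd_matrix_slice:
  assumes "\<And>i j. (\<lambda>q. A q $ i $ j) differentiable (at (yx y x))"
  shows "pd_matrix c (\<lambda>x. A (yx y x)) x = pd_matrix (Inr c) A (yx y x)"
  by (simp add: vec_eq_iff slice_derivative(2)[of "\<lambda>q. A q $ _ $ _", OF assms])

lemma pd_matrix_block: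
  "pd_matrix c (\<lambda>q. block11 (A q)) p = block11 (pd_matrix c A p)"
  "pd_matrix c (\<lambda>q. block12 (A q)) p = block12 (pd_matrix c A p)"
  "pd_matrix c (\<lambda>q. block21 (A q)) p = block21 (pd_matrix c A p)"
  "pd_matrix c (\<lambda>q. block22 (A q)) p = block22 (pd_matrix c A p)"
  by (simp_all add: vec_eq_iff block11_def block12_def block21_def block22_def)

lemma part_mult_vec:
  "ypart (M *v v) = block11 M *v ypart v + block12 M *v xpart v"
  "xpart (M *v v) = block21 M *v ypart v + block22 M *v xpart v"
  by (simp_all add: vec_eq_iff ypart_def xpart_def block11_def block12_def block21_def block22_def
      matrix_vector_mult_def sum_UNIV_sum)

lemma xpart_vec_mult: "xpart (v v* M) = ypart v v* block12 M + xpart v v* block22 M"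
  by (simp add: vec_eq_iff ypart_def xpart_def block12_def block22_def
      vector_matrix_mult_def sum_UNIV_sum)

section \<open>Rescaling a metric by a factor with zero differential\<close>

lemma christoffel_cong:
  assumes "open S" "p \<in> S" "\<And>q. q \<in> S \<Longrightarrow> g q = h q"
  shows "christoffel g i j k p = christoffel h i j k p"
proof -
  have "pd c (\<lambda>q. g q $ a $ b) p = pd c (\<lambda>q. h q $ a $ b) p" for a b c
    by (rule pd_cong_open[OF assms(1,2)]) (simp add: assms(3))
  then show ?thesis using assms(2,3) by (simp add: christoffel_def)
qed

lemma cov_deriv_cong:
  assumes "open S" "p \<in> S" "\<And>q. q \<in> S \<Longrightarrow> g q = h q" "\<And>q. q \<in> S \<Longrightarrow> B q = B' q"
  shows "cov_deriv g B a b c p = cov_deriv h B' a b c p"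
proof -
  have "pd c (\<lambda>q. B q $ a $ b) p = pd c (\<lambda>q. B' q $ a $ b) p"
    by (rule pd_cong_open[OF assms(1,2)]) (simp add: assms(4))
  moreover have "B p = B' p" by (simp add: assms(2,4))
  ultimately show ?thesis
    by (simp add: cov_deriv_def christoffel_cong[where g = g and h = h, OF assms(1,2,3)])
qed

text \<open>The factor scales the first derivatives of the metric and inversely scales the inverse
  metric, so it cancels.\<close>

lemma christoffel_scaleR:
  assumes "p \<in> S" "smooth_on S k" "smooth_entries S g" "invertible (g p)" "k p \<noteq> 0" "\<And>c. pd c k p = 0"
  shows "christoffel (\<lambda>q. k q *\<^sub>R g q) a b c p = christoffel g a b c p"
proof -
  have "pd l (\<lambda>q. (k q *\<^sub>R g q) $ i $ j) p = k p * pd l (\<lambda>q. g q $ i $ j) p" for l i j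
    using assms by (simp add: pd_mult smooth_on_differentiable smooth_entries_differentiable)
  moreover have cancel: "inverse (k p) * m * (k p * v) = m * v" for m v
    using assms(5) by simp
  ultimately show ?thesis
    using assms(5) by (simp add: christoffel_def matrix_inv_scaleR assms(4) cancel
      flip: right_diff_distrib distrib_left)
qed

text \<open>Both sides of the defining equation acquire the factor \<open>k\<close>. It is a
  function with vanishing derivatives rather than a constant, as suits det J1 on a slice that may be
  disconnected.\<close>

lemma scKt_scaleR:
  assumes "open S" "scKt S g J" "smooth_on S k" "\<And>p. p \<in> S \<Longrightarrow> k p \<noteq> 0" "\<And>p c. p \<in> S \<Longrightarrow> pd c k p = 0"
    and h: "\<And>p. p \<in> S \<Longrightarrow> h p = k p *\<^sub>R g p"
  shows "scKt S h J"
proof (rule scKtI)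
  let ?h = "\<lambda>p. k p *\<^sub>R g p"
  have g: "smooth_entries S g" "\<And>p. p \<in> S \<Longrightarrow> transpose (g p) = g p" "\<And>p. p \<in> S \<Longrightarrow> invertible (g p)"
    and J: "smooth_entries S J" "\<And>p. p \<in> S \<Longrightarrow> transpose (g p ** J p) = g p ** J p"
    using assms(2) by (auto simp: scKt_def pseudo_riemannian_def smooth_matrix_iff)
  show "open S" "smooth_entries S J" by fact+
  have "smooth_entries S h"
    using smooth_entries_scaleR[OF assms(1,3) g(1)] h
    by (simp add: smooth_entries_cong[OF assms(1), of h ?h])
  then show "pseudo_riemannian S h"
    using assms(4) by (auto simp: pseudo_riemannian_def smooth_matrix_iff h g transpose_scalar scalar_invertible)
  show "transpose (h p ** J p) = h p ** J p" if "p \<in> S" for p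
    using that by (simp add: h J transpose_scalar flip: scalar_matrix_assoc)
  fix p assume p: "p \<in> S"
  let ?\<alpha> = "d0 (\<lambda>q. trace (J q)) p"
  let ?B = "\<lambda>q. g q ** J q"
  have B: "smooth_entries S ?B" by (rule smooth_entries_mult[OF assms(1) g(1) J(1)])
  have cov: "cov_deriv g ?B a b c p = (1/2) * (?\<alpha> $ a * g p $ b $ c + ?\<alpha> $ b * g p $ a $ c)" for a b c
    using assms(2) p by (simp add: scKt_def smooth_matrix_iff Let_def)
  have "cov_deriv h (\<lambda>q. h q ** J q) a b c p = cov_deriv ?h (\<lambda>q. k q *\<^sub>R ?B q) a b c p" for a b c
    by (rule cov_deriv_cong[OF assms(1) p]) (simp_all add: h scalar_matrix_assoc)
  also have "cov_deriv ?h (\<lambda>q. k q *\<^sub>R ?B q) a b c p = k p * cov_deriv g ?B a b c p" for a b c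
  proof -
    have "pd c (\<lambda>q. (k q *\<^sub>R ?B q) $ a $ b) p = k p * pd c (\<lambda>q. ?B q $ a $ b) p"
      using assms(3,5) p B by (simp add: pd_mult smooth_on_differentiable smooth_entries_differentiable)
    moreover have "christoffel ?h a b c p = christoffel g a b c p" for a b c
      using assms(3-5) p g by (intro christoffel_scaleR[of _ S]) auto
    ultimately show ?thesis
      by (simp add: cov_deriv_def right_diff_distrib sum_distrib_left mult.left_commute)
  qed
  finally show "\<exists>\<beta>. \<forall>a b c. cov_deriv h (\<lambda>q. h q ** J q) a b c p
      = (1/2) * (\<beta> $ a * h p $ b $ c + \<beta> $ b * h p $ a $ c)"
    using h[OF p] by (intro exI[of _ ?\<alpha>]) (simp add: cov algebra_simps)
qed

lemma matrix_mult_minus_left: "(- A) ** B = - (A ** B)"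
  for A :: "real^'n^'m" and B :: "real^'k^'n"
  by (simp add: matrix_matrix_mult_def vec_eq_iff sum_negf)

section \<open>The Schur complement as a special conformal Killing tensor\<close>

lemma J2bar_schur: "J2bar J p = schur_complement (J p)"
  by (simp add: J2bar_def schur_complement_def J1_def)

text \<open>The conditions on \<open>g\<close> and \<open>J\<close> alone; the 1-form and its
  potentials enter only in the final theorem.\<close>

locale split_scKt =
  fixes S :: "(real^('m::finite + 'n::finite)) set" and g J :: "real^('m + 'n) \<Rightarrow> real^('m + 'n)^('m + 'n)"
  assumes open_S: "open S" and scKt: "scKt S g J"
    and g_off: "\<And>p. p \<in> S \<Longrightarrow> block12 (g p) = 0" "\<And>p. p \<in> S \<Longrightarrow> block21 (g p) = 0"
    and g_y: "\<And>p q. p \<in> S \<Longrightarrow> q \<in> S \<Longrightarrow> ypart p = ypart q \<Longrightarrow> block11 (g p) = block11 (g q)"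
    and g_x: "\<And>p q. p \<in> S \<Longrightarrow> q \<in> S \<Longrightarrow> xpart p = xpart q \<Longrightarrow> block22 (g p) = block22 (g q)"
    and J1_invertible: "\<And>p. p \<in> S \<Longrightarrow> invertible (J1 J p)"
begin

lemma smooth: "smooth_entries S g" "smooth_entries S J"
  and g_sym: "p \<in> S \<Longrightarrow> transpose (g p) = g p" and g_inv: "p \<in> S \<Longrightarrow> invertible (g p)"
  and gJ_sym: "p \<in> S \<Longrightarrow> transpose (g p ** J p) = g p ** J p"
  using scKt by (auto simp: scKt_def pseudo_riemannian_def smooth_matrix_iff)

lemma g_blocks: "p \<in> S \<Longrightarrow> blocks (block11 (g p)) 0 0 (block22 (g p)) = g p"
  by (metis g_off blocks_block)

lemma g_block_inv:
  assumes "p \<in> S"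
  shows "invertible (block11 (g p))" "invertible (block22 (g p))"
  using g_inv[OF assms] g_blocks[OF assms] det_blocks_diagonal[of "block11 (g p)" "block22 (g p)"]
  by (auto simp: invertible_det_nz)

lemma g_block_sym:
  assumes "p \<in> S"
  shows "transpose (block11 (g p)) = block11 (g p)" "transpose (block22 (g p)) = block22 (g p)"
  by (metis g_sym[OF assms] block_transpose(1)) (metis g_sym[OF assms] block_transpose(4))

lemma pd_g:
  assumes "p \<in> S"
  shows "pd k (\<lambda>q. g q $ Inl i $ Inr a) p = 0" "pd k (\<lambda>q. g q $ Inr a $ Inl i) p = 0"
    "pd (Inr c) (\<lambda>q. g q $ Inl i $ Inl j) p = 0" "pd (Inl l) (\<lambda>q. g q $ Inr a $ Inr b) p = 0"
proof -
  have "g q $ Inl i $ Inr a = 0" "g q $ Inr a $ Inl i = 0" if "q \<in> S" for q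
    using g_off[OF that] by (auto simp: block12_def block21_def vec_eq_iff)
  then show "pd k (\<lambda>q. g q $ Inl i $ Inr a) p = 0" "pd k (\<lambda>q. g q $ Inr a $ Inl i) p = 0"
    using pd_cong_open[OF open_S assms, of _ "\<lambda>q. 0"] by auto
  show "pd (Inr c) (\<lambda>q. g q $ Inl i $ Inl j) p = 0"
  proof (rule pd_eq_0_if_const_along_axis[OF open_S assms smooth_entries_differentiable[OF smooth(1) assms]])
    fix s assume "p + s *\<^sub>R axis (Inr c) 1 \<in> S"
    moreover have "ypart (p + s *\<^sub>R axis (Inr c) 1) = ypart p"
      by (simp add: ypart_def vec_eq_iff axis_def)
    ultimately have "block11 (g (p + s *\<^sub>R axis (Inr c) 1)) = block11 (g p)"
      using g_y assms by blast
    then show "g (p + s *\<^sub>R axis (Inr c) 1) $ Inl i $ Inl j = g p $ Inl i $ Inl j"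
      by (simp add: block11_def vec_eq_iff)
  qed
  show "pd (Inl l) (\<lambda>q. g q $ Inr a $ Inr b) p = 0"
  proof (rule pd_eq_0_if_const_along_axis[OF open_S assms smooth_entries_differentiable[OF smooth(1) assms]])
    fix s assume "p + s *\<^sub>R axis (Inl l) 1 \<in> S"
    moreover have "xpart (p + s *\<^sub>R axis (Inl l) 1) = xpart p"
      by (simp add: xpart_def vec_eq_iff axis_def)
    ultimately have "block22 (g (p + s *\<^sub>R axis (Inl l) 1)) = block22 (g p)"
      using g_x assms by blast
    then show "g (p + s *\<^sub>R axis (Inl l) 1) $ Inr a $ Inr b = g p $ Inr a $ Inr b"
      by (simp add: block22_def vec_eq_iff)
  qed
qed

text \<open>In a product metric, x-directions see only the connection of the x-factor. The two sides
  are compared after lowering with \<open>g\<close>, where \<open>pd_g\<close> annihilates every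
  symbol outside the lower right block.\<close>

lemma christoffel_matrix_blocks:
  assumes p: "yx y x \<in> S"
  shows "christoffel_matrix g (Inr c) (yx y x)
    = blocks 0 0 0 (christoffel_matrix (\<lambda>x. block22 (g (yx y x))) c x)"
proof -
  let ?p = "yx y x"
  let ?G = "\<lambda>x. block22 (g (yx y x))"
  let ?C = "christoffel_matrix g (Inr c) ?p"
  let ?Cs = "christoffel_matrix ?G c x"
  have low: "(g ?p ** ?C) $ k $ l = (1/2) * (pd l (\<lambda>q. g q $ k $ Inr c) ?p + pd (Inr c) (\<lambda>q. g q $ k $ l) ?p
      - pd k (\<lambda>q. g q $ l $ Inr c) ?p)" for k l
    by (rule metric_mult_christoffel) (rule g_inv[OF p])
  have pdG: "pd d (\<lambda>x. ?G x $ a $ b) x = pd (Inr d) (\<lambda>q. g q $ Inr a $ Inr b) ?p" for a b d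
    using slice_derivative(2)[OF smooth_entries_differentiable[OF smooth(1) p]] by (simp add: block22_def)
  have lows: "(?G x ** ?Cs) $ a $ b = (g ?p ** ?C) $ Inr a $ Inr b" for a b
    unfolding metric_mult_christoffel[where g = ?G and p = x, OF g_block_inv(2)[OF p]] low pdG by simp
  have "g ?p ** ?C = blocks 0 0 0 (?G x ** ?Cs)"
    by (simp add: vec_eq_iff all_sum lows) (simp add: low pd_g[OF p])
  also have "\<dots> = blocks (block11 (g ?p)) 0 0 (block22 (g ?p)) ** blocks 0 0 0 ?Cs"
    by (rule blocks_eqI) (simp_all add: block_mult)
  also have "\<dots> = g ?p ** blocks 0 0 0 ?Cs"
    by (simp only: g_blocks[OF p])
  finally have "g ?p ** (?C - blocks 0 0 0 ?Cs) = 0"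
    by (simp add: matrix_diff_ldistrib)
  then show ?thesis
    using matrix_mult_eq_0_left[OF g_inv[OF p]] by fastforce
qed

lemma gJ_block_sym:
  assumes "p \<in> S"
  shows "block11 (g p) ** block11 (J p) = transpose (block11 (J p)) ** block11 (g p)"
    "block22 (g p) ** block21 (J p) = transpose (block12 (J p)) ** block11 (g p)"
    "block22 (g p) ** block22 (J p) = transpose (block22 (J p)) ** block22 (g p)"
proof -
  have *: "g p ** J p = transpose (J p) ** g p"
    using gJ_sym[OF assms] g_sym[OF assms] by (simp add: matrix_transpose_mul)
  show "block11 (g p) ** block11 (J p) = transpose (block11 (J p)) ** block11 (g p)"
    "block22 (g p) ** block21 (J p) = transpose (block12 (J p)) ** block11 (g p)"
    "block22 (g p) ** block22 (J p) = transpose (block22 (J p)) ** block22 (g p)"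
    using arg_cong[OF *, of block11] arg_cong[OF *, of block21] arg_cong[OF *, of block22]
    by (simp_all add: block_mult g_off[OF assms] block_transpose)
qed

text \<open>The inverse of a self-adjoint endomorphism is self-adjoint.\<close>

lemma g11_J1_inv_sym:
  assumes "p \<in> S"
  shows "block11 (g p) ** matrix_inv (block11 (J p)) = transpose (matrix_inv (block11 (J p))) ** block11 (g p)"
proof -
  let ?A = "block11 (J p)" let ?M = "matrix_inv ?A" let ?g = "block11 (g p)"
  have M: "?A ** ?M = mat 1" "transpose ?M ** transpose ?A = mat 1"
    using matrix_inv_right[OF J1_invertible[OF assms]]
    by (simp_all add: J1_def transpose_mat flip: matrix_transpose_mul)
  have "transpose ?M ** ?g = transpose ?M ** (?g ** ?A) ** ?M"
    by (simp add: M flip: matrix_mul_assoc)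
  also have "\<dots> = (transpose ?M ** transpose ?A) ** ?g ** ?M"
    by (simp only: gJ_block_sym(1)[OF assms] matrix_mul_assoc)
  finally show ?thesis by (simp add: M)
qed

lemma schur_sym:
  assumes "p \<in> S"
  shows "transpose (block22 (g p) ** J2bar J p) = block22 (g p) ** J2bar J p"
proof -
  let ?M = "matrix_inv (block11 (J p))"
  \<comment> \<open>Symmetry of the lowered J turns the correction term into a congruence by
    \<open>block12 (J p)\<close> of the symmetric matrix \<open>block11 (g p) ** ?M\<close>.\<close>
  have X: "block22 (g p) ** (block21 (J p) ** ?M ** block12 (J p))
      = transpose (block12 (J p)) ** (block11 (g p) ** ?M) ** block12 (J p)"
    by (simp add: gJ_block_sym(2)[OF assms] matrix_mul_assoc)
  have "transpose (block22 (g p) ** block22 (J p)) = block22 (g p) ** block22 (J p)"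
    by (simp add: matrix_transpose_mul g_block_sym[OF assms] gJ_block_sym(3)[OF assms])
  moreover have "transpose (transpose (block12 (J p)) ** (block11 (g p) ** ?M) ** block12 (J p))
      = transpose (block12 (J p)) ** (block11 (g p) ** ?M) ** block12 (J p)"
    using g11_J1_inv_sym[OF assms]
    by (simp add: matrix_transpose_mul g_block_sym[OF assms] transpose_transpose matrix_mul_assoc)
  moreover have "transpose (A - B) = transpose A - transpose B" for A B :: "real^'n^'n"
    by (simp add: transpose_def vec_eq_iff)
  ultimately show ?thesis
    by (simp add: J2bar_def J1_def matrix_diff_ldistrib X)
qed

text \<open>The mixed equation for J in an x-direction, read off block by block. In the first block
  the connection has no entries, and the inhomogeneous terms vanish with the mixed entries of
  \<open>g\<close> and of the identity; hence J1 is constant along connected pieces of a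
  slice.\<close>

lemma pd_matrix_J:
  fixes c :: 'n
  assumes p: "yx y x \<in> S"
  defines "Cs \<equiv> christoffel_matrix (\<lambda>x. block22 (g (yx y x))) c x"
    and "\<alpha> \<equiv> d0 (\<lambda>q. trace (J q)) (yx y x)"
  defines "v \<equiv> matrix_inv (g (yx y x)) *v \<alpha>"
  shows "pd_matrix c (\<lambda>x. block11 (J (yx y x))) x = 0"
    "pd_matrix c (\<lambda>x. block12 (J (yx y x))) x = block12 (J (yx y x)) ** Cs
      + (\<chi> i b. (1/2) * (ypart v $ i * block22 (g (yx y x)) $ b $ c))"
    "pd_matrix c (\<lambda>x. block21 (J (yx y x))) x = - (Cs ** block21 (J (yx y x)))
      + (\<chi> a j. (1/2) * (mat 1 $ a $ c * ypart \<alpha> $ j))"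
    "pd_matrix c (\<lambda>x. block22 (J (yx y x))) x = block22 (J (yx y x)) ** Cs - Cs ** block22 (J (yx y x))
      + (\<chi> a b. (1/2) * (xpart v $ a * block22 (g (yx y x)) $ b $ c + mat 1 $ a $ c * xpart \<alpha> $ b))"
proof -
  let ?p = "yx y x"
  have dJ: "(\<lambda>q. J q $ i $ j) differentiable (at ?p)" for i j
    by (rule smooth_entries_differentiable[OF smooth(2) p])
  have slice: "pd_matrix c (\<lambda>x. J (yx y x)) x = J ?p ** blocks 0 0 0 Cs - blocks 0 0 0 Cs ** J ?p
      + (\<chi> a b. (1/2) * (v $ a * g ?p $ b $ Inr c + mat 1 $ a $ Inr c * \<alpha> $ b))"
    unfolding pd_matrix_slice[OF dJ] scKtD[OF open_S scKt p] christoffel_matrix_blocks[OF p]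
      Cs_def v_def \<alpha>_def ..
  have g0: "g ?p $ Inl j $ Inr c = 0" for j
    using g_off(1)[OF p] by (simp add: block12_def vec_eq_iff)
  have sub: "block11 (A - B) = block11 A - block11 B" "block12 (A - B) = block12 A - block12 B"
    "block21 (A - B) = block21 A - block21 B" "block22 (A - B) = block22 A - block22 B"
    "block11 (A + B) = block11 A + block11 B" "block12 (A + B) = block12 A + block12 B"
    "block21 (A + B) = block21 A + block21 B" "block22 (A + B) = block22 A + block22 B"
    for A B :: "real^('m + 'n)^('m + 'n)"
    by (simp_all add: block11_def block12_def block21_def block22_def vec_eq_iff)
  have N: "block11 (\<chi> a b. (1/2) * (v $ a * g ?p $ b $ Inr c + mat 1 $ a $ Inr c * \<alpha> $ b)) = 0"
    "block12 (\<chi> a b. (1/2) * (v $ a * g ?p $ b $ Inr c + mat 1 $ a $ Inr c * \<alpha> $ b))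
      = (\<chi> i b. (1/2) * (ypart v $ i * block22 (g ?p) $ b $ c))"
    "block21 (\<chi> a b. (1/2) * (v $ a * g ?p $ b $ Inr c + mat 1 $ a $ Inr c * \<alpha> $ b))
      = (\<chi> a j. (1/2) * (mat 1 $ a $ c * ypart \<alpha> $ j))"
    "block22 (\<chi> a b. (1/2) * (v $ a * g ?p $ b $ Inr c + mat 1 $ a $ Inr c * \<alpha> $ b))
      = (\<chi> a b. (1/2) * (xpart v $ a * block22 (g ?p) $ b $ c + mat 1 $ a $ c * xpart \<alpha> $ b))"
    by (simp_all add: block11_def block12_def block21_def block22_def vec_eq_iff g0 mat_def
        ypart_def xpart_def)
  show "pd_matrix c (\<lambda>x. block11 (J (yx y x))) x = 0"
    "pd_matrix c (\<lambda>x. block12 (J (yx y x))) x = block12 (J ?p) ** Cs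
      + (\<chi> i b. (1/2) * (ypart v $ i * block22 (g ?p) $ b $ c))"
    "pd_matrix c (\<lambda>x. block21 (J (yx y x))) x = - (Cs ** block21 (J ?p))
      + (\<chi> a j. (1/2) * (mat 1 $ a $ c * ypart \<alpha> $ j))"
    "pd_matrix c (\<lambda>x. block22 (J (yx y x))) x = block22 (J ?p) ** Cs - Cs ** block22 (J ?p)
      + (\<chi> a b. (1/2) * (xpart v $ a * block22 (g ?p) $ b $ c + mat 1 $ a $ c * xpart \<alpha> $ b))"
    unfolding pd_matrix_block slice sub block_mult N by simp_all
qed

lemma smooth_slice:
  "smooth_entries (x_slice S y) (\<lambda>x. block22 (g (yx y x)))"
  "smooth_entries (x_slice S y) (\<lambda>x. block11 (J (yx y x)))"
  "smooth_entries (x_slice S y) (\<lambda>x. block12 (J (yx y x)))"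
  "smooth_entries (x_slice S y) (\<lambda>x. block21 (J (yx y x)))"
  "smooth_entries (x_slice S y) (\<lambda>x. block22 (J (yx y x)))"
  using smooth_entries_slice[OF open_S smooth_entries_block(4)[OF smooth(1)]]
    smooth_entries_slice[OF open_S smooth_entries_block(1)[OF smooth(2)]]
    smooth_entries_slice[OF open_S smooth_entries_block(2)[OF smooth(2)]]
    smooth_entries_slice[OF open_S smooth_entries_block(3)[OF smooth(2)]]
    smooth_entries_slice[OF open_S smooth_entries_block(4)[OF smooth(2)]]
  by auto

lemma smooth_J1_inv_slice: "smooth_entries (x_slice S y) (\<lambda>x. matrix_inv (block11 (J (yx y x))))"
proof (rule smooth_entries_matrix_inv[OF open_x_slice[OF open_S] smooth_slice(2)])
  show "invertible (block11 (J (yx y x)))" if "x \<in> x_slice S y" for x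
    using J1_invertible[of "yx y x"] that by (simp add: J1_def x_slice_def)
qed

lemma smooth_J2bar_slice: "smooth_entries (x_slice S y) (\<lambda>x. J2bar J (yx y x))"
  unfolding J2bar_def J1_def
  by (rule smooth_entries_diff[OF open_x_slice[OF open_S] smooth_slice(5) smooth_entries_mult[OF open_x_slice[OF open_S]
        smooth_entries_mult[OF open_x_slice[OF open_S] smooth_slice(4) smooth_J1_inv_slice] smooth_slice(3)]])

text \<open>Since J1 is stationary along the slice, only the outer factors of the Schur complement
  are differentiated. Their connection terms assemble to the commutator with \<open>?K\<close>, and
  the inhomogeneous terms retain the required form with a corrected covector.\<close>

lemma scKt_J2bar: "scKt (x_slice S y) (\<lambda>x. block22 (g (yx y x))) (\<lambda>x. J2bar J (yx y x))"
proof (rule scKtI)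
  let ?T = "x_slice S y"
  let ?G = "\<lambda>x. block22 (g (yx y x))"
  let ?K = "\<lambda>x. J2bar J (yx y x)"
  show T: "open ?T" by (rule open_x_slice[OF open_S])
  show ps: "pseudo_riemannian ?T ?G"
    using g_block_sym(2) g_block_inv(2) smooth_slice(1) by (auto simp: pseudo_riemannian_def smooth_matrix_iff x_slice_def)
  show K: "smooth_entries ?T ?K" by (rule smooth_J2bar_slice)
  show "transpose (?G x ** ?K x) = ?G x ** ?K x" if "x \<in> ?T" for x
    using that schur_sym by (simp add: x_slice_def)
  fix x assume x: "x \<in> ?T"
  let ?p = "yx y x"
  have p: "?p \<in> S" using x by (simp add: x_slice_def)
  let ?\<alpha> = "d0 (\<lambda>q. trace (J q)) ?p"
  let ?v = "matrix_inv (g ?p) *v ?\<alpha>"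
  let ?M = "matrix_inv (block11 (J ?p))"
  let ?J12 = "block12 (J ?p)" let ?J21 = "block21 (J ?p)" let ?J22 = "block22 (J ?p)"
  \<comment> \<open>The correction to the x-part of \<open>?\<alpha>\<close>: the differential of
    the trace of \<open>?K\<close> turns out to be \<open>xpart ?\<alpha> - ?w\<close>.\<close>
  let ?w = "ypart ?\<alpha> v* (?M ** ?J12)"
  have v: "block11 (g ?p) *v ypart ?v = ypart ?\<alpha>" "?G x *v xpart ?v = xpart ?\<alpha>"
  proof -
    have "g ?p *v ?v = ?\<alpha>"
      by (simp add: matrix_vector_mul_assoc matrix_inv_right[OF g_inv[OF p]])
    then show "block11 (g ?p) *v ypart ?v = ypart ?\<alpha>" "?G x *v xpart ?v = xpart ?\<alpha>"
      using part_mult_vec[of "g ?p" ?v] by (simp_all add: g_off[OF p])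
  qed
  \<comment> \<open>Moving the off-diagonal block across the metric makes the correction from
    \<open>?N12\<close> equal to the one from \<open>?N21\<close>; without this the result would not
    be symmetric in \<open>a\<close> and \<open>b\<close>.\<close>
  have w: "(?G x ** ?J21 ** ?M) *v ypart ?v = ?w"
  proof -
    have "?G x ** ?J21 ** ?M = transpose (?M ** ?J12) ** block11 (g ?p)"
      using gJ_block_sym(2)[OF p] g11_J1_inv_sym[OF p]
      by (simp add: matrix_transpose_mul flip: matrix_mul_assoc)
    then show ?thesis by (simp add: v flip: matrix_vector_mul_assoc)
  qed
  show "\<exists>\<beta>. \<forall>a b c. cov_deriv ?G (\<lambda>x. ?G x ** ?K x) a b c x = (1/2) * (\<beta> $ a * ?G x $ b $ c + \<beta> $ b * ?G x $ a $ c)"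
  proof (intro exI allI)
    fix a b c
    let ?C = "christoffel_matrix ?G c x"
    let ?N12 = "\<chi> i b. (1/2) * (ypart ?v $ i * ?G x $ b $ c)"
    let ?N21 = "\<chi> a j. (1/2) * (mat 1 $ a $ c * ypart ?\<alpha> $ j)"
    let ?N22 = "\<chi> a b. (1/2) * (xpart ?v $ a * ?G x $ b $ c + mat 1 $ a $ c * xpart ?\<alpha> $ b)"
    note diff = smooth_entries_differentiable[OF _ x]
    have dM: "pd_matrix c (\<lambda>x. matrix_inv (block11 (J (yx y x)))) x = 0"
      using J1_invertible
      by (intro pd_matrix_matrix_inv_eq_0[OF T smooth_slice(2) _ x pd_matrix_J(1)[OF p]])
        (auto simp: J1_def x_slice_def)
    have dMul: "pd_matrix c (\<lambda>x. block21 (J (yx y x)) ** matrix_inv (block11 (J (yx y x))) ** block12 (J (yx y x))) x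
        = pd_matrix c (\<lambda>x. block21 (J (yx y x))) x ** ?M ** ?J12 + ?J21 ** ?M ** pd_matrix c (\<lambda>x. block12 (J (yx y x))) x"
      using diff[OF smooth_slice(3)] diff[OF smooth_slice(4)] diff[OF smooth_J1_inv_slice]
        diff[OF smooth_entries_mult[OF T smooth_slice(4) smooth_J1_inv_slice]]
      by (simp add: pd_matrix_mult dM)
    have "pd_matrix c ?K x = pd_matrix c (\<lambda>x. block22 (J (yx y x))) x
        - pd_matrix c (\<lambda>x. block21 (J (yx y x)) ** matrix_inv (block11 (J (yx y x))) ** block12 (J (yx y x))) x"
      unfolding J2bar_def J1_def
      by (intro pd_matrix_diff diff smooth_slice smooth_entries_mult smooth_J1_inv_slice T)
    also have "\<dots> = ?K x ** ?C - ?C ** ?K x + (?N22 - ?N21 ** ?M ** ?J12 - ?J21 ** ?M ** ?N12)"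
      unfolding dMul pd_matrix_J[OF p]
      by (simp add: J2bar_def J1_def matrix_diff_ldistrib matrix_diff_rdistrib matrix_add_ldistrib
          matrix_add_rdistrib matrix_mult_minus_left matrix_mul_assoc)
    finally have dK: "pd_matrix c ?K x + ?C ** ?K x - ?K x ** ?C = ?N22 - ?N21 ** ?M ** ?J12 - ?J21 ** ?M ** ?N12"
      by simp
    have "cov_deriv ?G (\<lambda>x. ?G x ** ?K x) a b c x = (?G x ** (?N22 - ?N21 ** ?M ** ?J12 - ?J21 ** ?M ** ?N12)) $ a $ b"
      using arg_cong[OF cov_deriv_lowered[OF T x ps K, of c], of "\<lambda>M. M $ a $ b"] by (simp only: dK vec_lambda_beta)
    also have "\<dots> = (?G x ** ?N22) $ a $ b - ((?G x ** ?N21) ** (?M ** ?J12)) $ a $ b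
        - ((?G x ** ?J21 ** ?M) ** ?N12) $ a $ b"
      by (simp add: matrix_diff_ldistrib matrix_mul_assoc)
    also have "(?G x ** ?N22) $ a $ b = (1/2) * ((?G x *v xpart ?v) $ a * ?G x $ b $ c + (?G x ** mat 1) $ a $ c * xpart ?\<alpha> $ b)"
      by (simp only: matrix_matrix_mult_def matrix_vector_mult_def vec_lambda_beta)
        (simp add: sum_distrib_left sum_distrib_right sum.distrib algebra_simps)
    also have "((?G x ** ?N21) ** (?M ** ?J12)) $ a $ b = (1/2) * (?G x $ a $ c * ?w $ b)"
    proof -
      have "?G x ** ?N21 = (\<chi> a j. (1/2) * ((?G x ** mat 1) $ a $ c * ypart ?\<alpha> $ j))"
        by (simp only: matrix_matrix_mult_def vec_lambda_beta vec_eq_iff)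
          (simp add: sum_distrib_left sum_distrib_right mult_ac)
      then have "?G x ** ?N21 = (\<chi> a j. (1/2) * (?G x $ a $ c * ypart ?\<alpha> $ j))" by simp
      then show ?thesis
        by (simp only: matrix_matrix_mult_def[of "\<chi> a j. (1/2) * (?G x $ a $ c * ypart ?\<alpha> $ j)"]
            vector_matrix_mult_nth vec_lambda_beta)
          (simp add: sum_distrib_left mult_ac)
    qed
    also have "((?G x ** ?J21 ** ?M) ** ?N12) $ a $ b = (1/2) * (((?G x ** ?J21 ** ?M) *v ypart ?v) $ a * ?G x $ b $ c)"
      by (simp only: matrix_matrix_mult_def[of "?G x ** ?J21 ** ?M"] matrix_vector_mult_def vec_lambda_beta)
        (simp add: sum_distrib_left sum_distrib_right mult_ac)
    finally show "cov_deriv ?G (\<lambda>x. ?G x ** ?K x) a b c x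
        = (1/2) * ((xpart ?\<alpha> - ?w) $ a * ?G x $ b $ c + (xpart ?\<alpha> - ?w) $ b * ?G x $ a $ c)"
      unfolding v w by (simp add: algebra_simps)
  qed
qed

lemma pd_det_J1:
  assumes p: "yx y x \<in> S"
  shows "pd c (\<lambda>x. det (J1 J (yx y x))) x = 0"
proof -
  have "x \<in> x_slice S y" using p by (simp add: x_slice_def)
  from pd_det_matrix[OF smooth_entries_differentiable[OF smooth_slice(2) this], of c] show ?thesis
    by (simp add: J1_def pd_matrix_J(1)[OF p] trace_def)
qed

text \<open>The metric \<open>h\<close> is the slice metric divided by det J1, a factor whose
  differential along the slice vanishes by \<open>pd_det_J1\<close>.\<close>

lemma scKt_J2bar_scaled:
  assumes "\<And>x. x \<in> x_slice S y \<Longrightarrow> h x = matrix_inv (det (J1 J (yx y x)) *\<^sub>R matrix_inv (block22 (g (yx y x))))"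
  shows "scKt (x_slice S y) h (\<lambda>x. J2bar J (yx y x))"
proof (rule scKt_scaleR[OF open_x_slice[OF open_S] scKt_J2bar])
  let ?T = "x_slice S y" let ?d = "\<lambda>x. det (J1 J (yx y x))"
  have nz: "?d x \<noteq> 0" if "x \<in> ?T" for x
    using J1_invertible that by (auto simp: invertible_det_nz x_slice_def)
  have sm: "smooth_on ?T ?d"
    unfolding J1_def by (intro smooth_on_det open_x_slice open_S smooth_slice)
  show "smooth_on ?T (\<lambda>x. inverse (?d x))"
    using nz by (intro smooth_on_inverse open_x_slice open_S sm)
  fix x assume x: "x \<in> ?T"
  show "inverse (?d x) \<noteq> 0" using nz[OF x] by simp
  show "pd c (\<lambda>x. inverse (?d x)) x = 0" for c
    using x nz[OF x] smooth_on_differentiable[OF sm x] pd_det_J1 by (simp add: pd_inverse x_slice_def)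
  show "h x = inverse (?d x) *\<^sub>R block22 (g (yx y x))"
    using x nz[OF x] g_block_inv(2)
    by (simp add: assms matrix_inv_scaleR invertible_matrix_inv matrix_inv_matrix_inv x_slice_def)
qed

end

section \<open>The closed 1-form on a slice and admissibility of the potential\<close>

lemma d1_diff_scaled:
  assumes "\<And>i. (\<lambda>q. \<rho> q $ i) differentiable (at p)" "\<And>i. (\<lambda>q. \<sigma> q $ i) differentiable (at p)"
    "d1 \<rho> p = 0" "d1 \<sigma> p = 0"
  shows "d1 (\<lambda>q. c *\<^sub>R \<rho> q - \<sigma> q) p = 0"
proof -
  have "pd k (\<lambda>q. (c *\<^sub>R \<rho> q - \<sigma> q) $ l) p = c * pd k (\<lambda>q. \<rho> q $ l) p - pd k (\<lambda>q. \<sigma> q $ l) p" for k l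
    using assms(1,2) by (simp add: pd_diff pd_cmult)
  then show ?thesis
    using assms(3,4) by (simp add: d1_def vec_eq_iff flip: right_diff_distrib)
qed

lemma d1_cong:
  assumes "open S" "p \<in> S" "\<And>q. q \<in> S \<Longrightarrow> \<rho> q = \<sigma> q"
  shows "d1 \<rho> p = d1 \<sigma> p"
proof -
  have "pd k (\<lambda>q. \<rho> q $ l) p = pd k (\<lambda>q. \<sigma> q $ l) p" for k l
    by (rule pd_cong_open[OF assms(1,2)]) (simp add: assms(3))
  then show ?thesis by (simp add: d1_def)
qed

text \<open>Taking the x-part along a slice is pullback under its inclusion, which commutes with the
  exterior derivative.\<close>

lemma d1_xpart_slice:
  assumes "\<And>i. (\<lambda>q. \<rho> q $ i) differentiable (at (yx y x))" "d1 \<rho> (yx y x) = 0"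
  shows "d1 (\<lambda>x. xpart (\<rho> (yx y x))) x = 0"
proof -
  have "d1 (\<lambda>x. xpart (\<rho> (yx y x))) x $ a $ b = d1 \<rho> (yx y x) $ Inr a $ Inr b" for a b
    by (simp add: d1_def xpart_def slice_derivative(2)[OF assms(1)])
  then show ?thesis by (simp add: vec_eq_iff assms(2))
qed

theorem proposition5:
  fixes S :: "(real^('m::finite + 'n::finite)) set"
    and g J :: "real^('m + 'n) \<Rightarrow> real^('m + 'n)^('m + 'n)"
    and \<mu> :: "real^('m + 'n) \<Rightarrow> real^('m + 'n)"
    and A :: "nat \<Rightarrow> real^('m + 'n) \<Rightarrow> real^('m + 'n)^('m + 'n)"
    and W1 :: "real^'m \<Rightarrow> real"
    and Wn :: "real^('m + 'n) \<Rightarrow> real"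
    and E1 :: real
    and H :: "real^'m \<Rightarrow> real^'n \<Rightarrow> real^'n \<Rightarrow> real"
    and h :: "real^'m \<Rightarrow> real^'n \<Rightarrow> real^'n^'n"
    and U :: "real^'m \<Rightarrow> real^'n \<Rightarrow> real"
  assumes system: "driven_cofactor_system S g \<mu> J"
    and J1_nonsingular: "\<forall>p\<in>S. invertible (J1 J p)"
    and A: "\<forall>p\<in>S. \<forall>a::real. adjugate (J p + a *\<^sub>R P2) = (\<Sum>i = 1..CARD('n) + 1. a ^ (i - 1) *\<^sub>R A i p)"
    and Wn: "smooth_on S Wn" "\<forall>p\<in>S. \<mu> p v* A CARD('n) p = - d0 Wn p"
    and W1: "smooth_on (ypart ` S) W1"
      "\<forall>p\<in>S. ypart (\<mu> p) v* adjugate (J1 J p) = - d0 W1 (ypart p)"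
    and H_def: "\<And>y x p. H y x p =
      (1/2) * det (J1 J (yx y x)) *
        (\<Sum>a\<in>UNIV. \<Sum>b\<in>UNIV. matrix_inv (block22 (g (yx y x))) $ a $ b * p $ a * p $ b)
      + trace (J2bar J (yx y x)) * (E1 - W1 y) + Wn (yx y x)"
    and h_def: "\<And>y x. h y x =
      matrix_inv (det (J1 J (yx y x)) *\<^sub>R matrix_inv (block22 (g (yx y x))))"
    and U_def: "\<And>y x. U y x = trace (J2bar J (yx y x)) * (E1 - W1 y) + Wn (yx y x)"
  shows "\<forall>y. natural_hamiltonian (x_slice S y) (h y) (U y) (H y) \<and>
      scKt (x_slice S y) (h y) (\<lambda>x. J2bar J (yx y x)) \<and>
      admissible_potential (x_slice S y) (\<lambda>x. J2bar J (yx y x)) (U y)"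
proof
  fix y
  let ?T = "x_slice S y"
  let ?K = "\<lambda>x. J2bar J (yx y x)"
  let ?\<rho> = "\<lambda>q. \<mu> q v* adjugate (J q)"
  let ?e = "E1 - W1 y"
  let ?W = "\<lambda>x. Wn (yx y x)"
  have cof: "cofactor_system S g \<mu> J" and open_S: "open S"
    using system by (auto simp: driven_cofactor_system_def coordinate_domain_def)
  have \<mu>: "smooth_form S \<mu>" "\<And>p. p \<in> S \<Longrightarrow> DJ1 J \<mu> p = 0"
    and J: "scKt S g J" "\<And>p. p \<in> S \<Longrightarrow> invertible (J p)"
    using cof by (auto simp: cofactor_system_def)
  interpret split_scKt S g J
  proof
    show "block12 (g p) = 0" "block21 (g p) = 0" if "p \<in> S" for p
      using system that unfolding driven_cofactor_system_def by blast+
    show "block11 (g p) = block11 (g q)" if "p \<in> S" "q \<in> S" "ypart p = ypart q" for p q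
      using system that unfolding driven_cofactor_system_def by blast
    show "block22 (g p) = block22 (g q)" if "p \<in> S" "q \<in> S" "xpart p = xpart q" for p q
      using system that unfolding driven_cofactor_system_def by blast
    show "invertible (J1 J p)" if "p \<in> S" for p
      using J1_nonsingular that by blast
  qed (fact open_S J(1))+
  have U_fun: "U y = (\<lambda>x. trace (?K x) * ?e + ?W x)" by (rule ext) (rule U_def)
  have T: "open ?T" by (rule open_x_slice[OF open_S])
  have mem: "yx y x \<in> S" if "x \<in> ?T" for x using that by (simp add: x_slice_def)
  \<comment> \<open>det J is the product of det J1 and the determinant of \<open>?K\<close>, and
    both J and J1 are nonsingular.\<close>
  have K_inv: "invertible (?K x)" if "x \<in> ?T" for x
    using det_schur[of "J (yx y x)"] J(2)[OF mem[OF that]] J1_invertible[OF mem[OF that]]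
    by (auto simp: invertible_det_nz J2bar_schur J1_def)
  have scKt_h: "scKt ?T (h y) ?K"
    by (rule scKt_J2bar_scaled) (rule h_def)

  have "natural_hamiltonian ?T (h y) (U y) (H y)"
    unfolding natural_hamiltonian_def
  proof (intro ballI allI)
    fix x p assume x: "x \<in> ?T"
    have "invertible (det (J1 J (yx y x)) *\<^sub>R matrix_inv (block22 (g (yx y x))))"
      using J1_invertible[OF mem[OF x]] g_block_inv(2)[OF mem[OF x]]
      by (intro scalar_invertible invertible_matrix_inv) (auto simp: invertible_det_nz)
    then have "matrix_inv (h y x) = det (J1 J (yx y x)) *\<^sub>R matrix_inv (block22 (g (yx y x)))"
      unfolding h_def by (rule matrix_inv_matrix_inv)
    then show "H y x p = (1/2) * (\<Sum>a\<in>UNIV. \<Sum>b\<in>UNIV. matrix_inv (h y x) $ a $ b * p $ a * p $ b) + U y x"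
      by (simp add: H_def U_def sum_distrib_left mult.assoc)
  qed
  moreover
  have smooth_K: "smooth_entries ?T ?K" by (rule smooth_J2bar_slice)
  have smooth_tr: "smooth_on ?T (\<lambda>x. trace (?K x))" by (rule smooth_on_trace[OF T smooth_K])
  have smooth_det: "smooth_on ?T (\<lambda>x. det (?K x))" by (rule smooth_on_det[OF T smooth_K])
  have smooth_W: "smooth_on ?T ?W" by (rule smooth_on_slice[OF open_S Wn(1)])
  have smooth_U: "smooth_on ?T (U y)"
    unfolding U_fun by (intro smooth_on_intros T smooth_tr smooth_W)
  have smooth_\<rho>: "smooth_form S ?\<rho>"
    by (intro smooth_form_vector_matrix_mult smooth_entries_adjugate open_S \<mu>(1) smooth(2))
  \<comment> \<open>The 1-form in question is a constant multiple of an exact form minus the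
    pullback of (cof J) mu; the coefficient \<open>?e\<close> is constant because \<open>y\<close>
    is fixed.\<close>
  have form: "d0 (U y) x v* adjugate (?K x) = ?e *\<^sub>R d0 (\<lambda>x. det (?K x)) x - xpart (?\<rho> (yx y x))"
    if x: "x \<in> ?T" for x
  proof -
    let ?p = "yx y x"
    note p = mem[OF x]
    have dW: "d0 ?W x = - xpart (\<mu> ?p v* A CARD('n) ?p)"
    proof -
      have "d0 ?W x = xpart (d0 Wn ?p)"
        using slice_derivative(2)[OF smooth_on_differentiable[OF Wn(1) p]]
        by (simp add: d0_def xpart_def vec_eq_iff)
      moreover have "d0 Wn ?p = - (\<mu> ?p v* A CARD('n) ?p)" using Wn(2) p by simp
      ultimately show ?thesis by (simp add: xpart_def vec_eq_iff)
    qed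
    have "d0 (U y) x = ?e *\<^sub>R d0 (\<lambda>x. trace (?K x)) x + d0 ?W x"
      using smooth_on_differentiable[OF smooth_tr x] smooth_on_differentiable[OF smooth_W x]
      by (simp add: U_fun d0_def vec_eq_iff pd_add pd_mult)
    then have "d0 (U y) x v* adjugate (?K x) = ?e *\<^sub>R d0 (\<lambda>x. det (?K x)) x + d0 ?W x v* adjugate (?K x)"
      by (simp add: scKt_d0_det[OF T scKt_h x K_inv[OF x]] vector_matrix_left_distrib scaleR_vector_matrix_assoc)
    also have "d0 ?W x v* adjugate (?K x) = - (xpart (\<mu> ?p v* A CARD('n) ?p) v* adjugate (?K x))"
      unfolding dW using vector_matrix_mult_diff_distrib[of 0] by simp
    \<comment> \<open>The x-part depends only on the x-columns of the coefficient, and multiplying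
      these by the cofactor of \<open>?K\<close> gives the x-columns of cof J.\<close>
    also have "xpart (\<mu> ?p v* A CARD('n) ?p) v* adjugate (?K x) = xpart (?\<rho> ?p)"
      using adjugate_pencil_coefficient[of "J ?p" "\<lambda>i. A i ?p"] A p J(2)[OF p] J1_invertible[OF p]
      by (simp add: xpart_vec_mult vector_matrix_left_distrib vector_matrix_mul_assoc J2bar_schur J1_def)
    finally show ?thesis by simp
  qed
  have "closed_form ?T (\<lambda>x. d0 (U y) x v* adjugate (?K x))"
    unfolding closed_form_def
  proof (intro conjI ballI)
    show "smooth_form ?T (\<lambda>x. d0 (U y) x v* adjugate (?K x))"
      by (intro smooth_form_vector_matrix_mult smooth_form_d0 smooth_entries_adjugate T smooth_U smooth_K)
    fix x assume x: "x \<in> ?T"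
    note p = mem[OF x]
    have d\<rho>: "(\<lambda>q. ?\<rho> q $ i) differentiable (at (yx y x))" for i
      using smooth_\<rho> p smooth_on_differentiable unfolding smooth_form_def by blast
    have "d1 (\<lambda>x. d0 (U y) x v* adjugate (?K x)) x
        = d1 (\<lambda>x. ?e *\<^sub>R d0 (\<lambda>x. det (?K x)) x - xpart (?\<rho> (yx y x))) x"
      by (rule d1_cong[OF T x form])
    also have "\<dots> = 0"
    proof (rule d1_diff_scaled)
      show "(\<lambda>x. d0 (\<lambda>x. det (?K x)) x $ i) differentiable (at x)" for i
        using smooth_form_d0[OF smooth_det] x smooth_on_differentiable unfolding smooth_form_def by blast
      show "(\<lambda>x. xpart (?\<rho> (yx y x)) $ i) differentiable (at x)" for i
        using slice_derivative(1)[OF d\<rho>] by (simp add: xpart_def)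
      show "d1 (d0 (\<lambda>x. det (?K x))) x = 0" by (rule d1_d0[OF T smooth_det x])
      show "d1 (\<lambda>x. xpart (?\<rho> (yx y x))) x = 0"
        by (rule d1_xpart_slice[OF d\<rho> d1_cofactor_form_eq_0[OF open_S J(1) p J(2) \<mu>(1) \<mu>(2)[OF p]]])
    qed
    finally show "d1 (\<lambda>x. d0 (U y) x v* adjugate (?K x)) x = 0" .
  qed
  with smooth_U have "admissible_potential ?T ?K (U y)"
    by (simp add: admissible_potential_def)
  ultimately show "natural_hamiltonian ?T (h y) (U y) (H y) \<and> scKt ?T (h y) ?K \<and> admissible_potential ?T ?K (U y)"
    using scKt_h by blast
qed

end
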